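(* There exist absolute constants $C, c > 0$ such that the following holds. Let $n \ge 2$, let $D$ be an arbitrary fixed $n \times n$ complex matrix, and let $U$ be a random matrix uniformly distributed in the unitary group $U(n)$. Then $$\mathbb{P}\{ s_{\min}(D+U) \le t \} \le t^{c}\, n^{C} \quad \text{for all } t > 0.$$
   Context: For an $n\times n$ complex matrix $A$, $s_{\min}(A)$ denotes its smallest singular value, i.e. the smallest eigenvalue of $(A^*A)^{1/2}$. "Uniformly distributed" means distributed according to the normalized Haar measure. The constants $C,c$ do not depend on $n$, $D$ or $t$. *)

theory Defs
  imports "HOL-Probability.Probability" "Jordan_Normal_Form.Schur_Decomposition"
begin

definition unitary_group :: "nat \<Rightarrow> complex mat set" where
  "unitary_group n = {U \<in> carrier_mat n n. mat_adjoint U * U = 1\<^sub>m n \<and> U * mat_adjoint U = 1\<^sub>m n}"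

definition pos_semidef_mat :: "complex mat \<Rightarrow> bool" where
  "pos_semidef_mat P \<longleftrightarrow> square_mat P \<and> mat_adjoint P = P \<and>
     (\<forall>v \<in> carrier_vec (dim_row P). 0 \<le> Re ((P *\<^sub>v v) \<bullet>c v))"

(* Every positive semidefinite B has exactly one positive semidefinite square root;
   this constant is only meaningful for such B. *)
definition mat_sqrt :: "complex mat \<Rightarrow> complex mat" where
  "mat_sqrt B = (THE P. pos_semidef_mat P \<and> P * P = B)"

(* The eigenvalues of the square root are real; the set is finite, and nonempty
   for square A of size at least 1. *)
definition s_min :: "complex mat \<Rightarrow> real" where
  "s_min A = Min {s :: real. eigenvalue (mat_sqrt (mat_adjoint A * A)) (complex_of_real s)}"

(* The Borel sigma-algebra of U(n) as a subspace of C^(n*n): since C is second countable,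
   the product sigma-algebra on C^(n*n) is its Borel sigma-algebra. *)
definition unitary_borel :: "nat \<Rightarrow> complex mat measure" where
  "unitary_borel n = vimage_algebra (unitary_group n)
     (\<lambda>A. \<lambda>(i, j) \<in> {..<n} \<times> {..<n}. A $$ (i, j))
     (\<Pi>\<^sub>M ij \<in> {..<n} \<times> {..<n}. (borel :: complex measure))"

(* Normalized Haar measure. Left invariance suffices: by uniqueness and compactness of U(n)
   it entails right invariance, and regularity is automatic for finite Borel measures here. *)
definition haar_unitary :: "nat \<Rightarrow> complex mat measure \<Rightarrow> bool" where
  "haar_unitary n \<mu> \<longleftrightarrow>
     sets \<mu> = sets (unitary_borel n) \<and> prob_space \<mu> \<and>
     (\<forall>V \<in> unitary_group n. \<forall>S \<in> sets \<mu>. emeasure \<mu> ((\<lambda>U. V * U) ` S) = emeasure \<mu> S)"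

end

theory Submission
  imports Defs "Jordan_Normal_Form.Spectral_Radius"
begin

text \<open>Let \<open>W = U (D + U)\<^sup>-\<^sup>1\<close>. For a fixed vector \<open>v\<close>, multiply \<open>U\<close> from the left by the rotation
  that scales \<open>v\<close> by a unit complex number \<open>z\<close> and fixes its orthogonal complement; this preserves
  Haar measure. By the resolvent identity, \<open>\<langle>W v, v\<rangle>\<close> becomes \<open>z / (z + b)\<close> for \<open>|v| = 1\<close>, with
  \<open>b\<close> independent of \<open>z\<close>, so among \<open>m\<close> values of \<open>z\<close> on the circle that are \<open>1/m\<close>-separated at most
  one makes it exceed \<open>2m\<close>. Hence \<open>|\<langle>W v, v\<rangle>| > 2m\<close> has probability at most \<open>1/m\<close>. Complex
  polarization turns this into a bound on all entries of \<open>W\<close>, and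
  \<open>\<parallel>(D + U)\<^sup>-\<^sup>1\<parallel> = \<parallel>W\<parallel>\<close>, which gives \<open>c = 1\<close>.\<close>

section \<open>Adjoints and the spectral theorem\<close>

lemma mat_adjoint_dim [simp]:
  "dim_row (mat_adjoint A) = dim_col A" "dim_col (mat_adjoint A) = dim_row A"
  unfolding mat_adjoint_def by simp_all

lemma mat_adjoint_carrier [simp]:
  "A \<in> carrier_mat nr nc \<Longrightarrow> mat_adjoint A \<in> carrier_mat nc nr"
  by auto

lemma mat_adjoint_index [simp]:
  "i < dim_col A \<Longrightarrow> j < dim_row A \<Longrightarrow> mat_adjoint A $$ (i, j) = conjugate (A $$ (j, i))"
  unfolding mat_adjoint_def by (simp add: mat_of_rows_index)

lemma mat_adjoint_adjoint [simp]: "mat_adjoint (mat_adjoint A) = A"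
  by (rule eq_matI) auto

lemma mat_adjoint_one [simp]: "mat_adjoint (1\<^sub>m n :: complex mat) = 1\<^sub>m n"
  by (rule eq_matI) auto

lemma mat_adjoint_mult:
  fixes A B :: "complex mat"
  assumes "A \<in> carrier_mat nr n" "B \<in> carrier_mat n nc"
  shows "mat_adjoint (A * B) = mat_adjoint B * mat_adjoint A"
  using assms by (intro eq_matI) (auto simp: scalar_prod_def mult.commute intro!: sum.cong)

lemma cscalar_prod_adjoint:
  fixes A :: "complex mat"
  assumes "A \<in> carrier_mat nr nc" "v \<in> carrier_vec nc" "w \<in> carrier_vec nr"
  shows "(A *\<^sub>v v) \<bullet>c w = v \<bullet>c (mat_adjoint A *\<^sub>v w)"
proof -
  have "(A *\<^sub>v v) \<bullet>c w = (\<Sum>i<nr. \<Sum>j<nc. A $$ (i, j) * v $ j * cnj (w $ i))"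
    using assms by (auto simp: scalar_prod_def sum_distrib_right atLeast0LessThan intro!: sum.cong)
  also have "\<dots> = (\<Sum>j<nc. \<Sum>i<nr. A $$ (i, j) * v $ j * cnj (w $ i))"
    by (rule sum.swap)
  also have "\<dots> = v \<bullet>c (mat_adjoint A *\<^sub>v w)"
    using assms
    by (auto simp: scalar_prod_def sum_distrib_left atLeast0LessThan mult_ac intro!: sum.cong)
  finally show ?thesis .
qed

lemma cscalar_prod_self:
  fixes v :: "complex vec"
  shows "v \<bullet>c v = complex_of_real (\<Sum>i<dim_vec v. (cmod (v $ i))\<^sup>2)"
  by (auto simp: scalar_prod_def atLeast0LessThan complex_norm_square intro!: sum.cong
      simp del: of_real_power)

text \<open>A left inverse of a square matrix is also a right inverse, so one of the two identities
  is enough.\<close>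

lemma unitary_groupI:
  assumes "U \<in> carrier_mat n n" "mat_adjoint U * U = 1\<^sub>m n"
  shows "U \<in> unitary_group n"
  using assms mat_mult_left_right_inverse[of "mat_adjoint U" n U]
  unfolding unitary_group_def by auto

lemma unitary_groupD:
  assumes "U \<in> unitary_group n"
  shows "U \<in> carrier_mat n n" "mat_adjoint U * U = 1\<^sub>m n" "U * mat_adjoint U = 1\<^sub>m n"
  using assms unfolding unitary_group_def by auto

lemma unitary_group_mult:
  assumes "U \<in> unitary_group n" "V \<in> unitary_group n"
  shows "U * V \<in> unitary_group n"
proof (rule unitary_groupI)
  note U = unitary_groupD[OF assms(1)] and V = unitary_groupD[OF assms(2)]
  show "U * V \<in> carrier_mat n n" using U V by auto
  have "mat_adjoint (U * V) * (U * V) = mat_adjoint V * (mat_adjoint U * U) * V"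
    using U(1) V(1)
    by (simp add: mat_adjoint_mult assoc_mult_mat[of _ n n _ n _ n] mult_carrier_mat[of _ n n _ n])
  also have "\<dots> = 1\<^sub>m n" using U V by simp
  finally show "mat_adjoint (U * V) * (U * V) = 1\<^sub>m n" .
qed

text \<open>Complete \<open>v\<close> to a basis and orthogonalize; Gram-Schmidt leaves the first
  vector unchanged. The factor \<open>c\<close> is the reciprocal of the length of \<open>v\<close>.
  This is the change of basis that splits off an eigenvector in the diagonalization below.\<close>

lemma unitary_with_first_column:
  fixes v :: "complex vec"
  assumes v: "v \<in> carrier_vec n" "v \<noteq> 0\<^sub>v n"
  obtains W c where "W \<in> unitary_group n" "c \<noteq> 0" "col W 0 = c \<cdot>\<^sub>v v"
proof -
  interpret cof_vec_space n "TYPE(complex)" .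
  define b where "b = basis_completion v"
  note bc = basis_completion[OF v, folded b_def]
  define ws where "ws = gram_schmidt n b"
  have ws: "set ws \<subseteq> carrier_vec n" "corthogonal ws" "length ws = n"
    using gram_schmidt_result[OF bc(2,4,5) ws_def] bc(6) by auto
  have n: "n > 0" using v by (cases n) auto
  then obtain vs where "b = v # vs" using bc(6,7) by (cases b) auto
  hence "hd ws = v" using gram_schmidt_hd[OF v(1)] unfolding ws_def by simp
  hence ws0: "ws ! 0 = v" using n ws(3) by (cases ws) auto
  \<comment> \<open>\<open>gram_schmidt\<close> gives orthogonal vectors that need not have length
    one, so each column of \<open>W\<close> is divided by its length \<open>r j\<close>.\<close>
  define r where "r j = sqrt (\<Sum>k<n. (cmod (ws ! j $ k))\<^sup>2)" for j
  have carr: "ws ! j \<in> carrier_vec n" if "j < n" for j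
    using ws that by auto
  have sq: "ws ! j \<bullet>c ws ! j = complex_of_real ((r j)\<^sup>2)" if "j < n" for j
    using carr[OF that] unfolding cscalar_prod_self r_def
    by (subst real_sqrt_pow2) (auto intro!: sum_nonneg)
  have r0: "r j \<noteq> 0" if "j < n" for j
    using corthogonalD[OF ws(2), of j j] sq[OF that] that ws(3) by auto
  define W where "W = mat n n (\<lambda>(i, j). ws ! j $ i / complex_of_real (r j))"
  have "mat_adjoint W * W = 1\<^sub>m n"
  proof (rule eq_matI)
    fix i j assume "i < dim_row (1\<^sub>m n :: complex mat)" "j < dim_col (1\<^sub>m n :: complex mat)"
    hence ij: "i < n" "j < n" by auto
    have "(mat_adjoint W * W) $$ (i, j) = (ws ! j \<bullet>c ws ! i) / complex_of_real (r i * r j)"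
      using ij carr[OF ij(1)] carr[OF ij(2)] unfolding W_def
      by (auto simp: scalar_prod_def sum_divide_distrib mult_ac intro!: sum.cong)
    also have "\<dots> = (1\<^sub>m n :: complex mat) $$ (i, j)"
      using corthogonalD[OF ws(2), of j i] ij ws(3) sq[of i] r0[of i]
      by (auto simp: power2_eq_square)
    finally show "(mat_adjoint W * W) $$ (i, j) = 1\<^sub>m n $$ (i, j)" .
  qed (auto simp: W_def)
  hence "W \<in> unitary_group n" by (intro unitary_groupI) (auto simp: W_def)
  moreover have "col W 0 = (1 / complex_of_real (r 0)) \<cdot>\<^sub>v v"
    using n v(1) ws0 by (intro eq_vecI) (auto simp: W_def)
  ultimately show thesis using that[of W "1 / complex_of_real (r 0)"] r0[of 0] n by auto
qed

text \<open>Induction on the size. Conjugation by a unitary matrix whose first column is an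
  eigenvector clears the rest of the first column; since the result is again Hermitian, the rest of
  the first row vanishes too. What remains is a Hermitian block of size \<open>n\<close>.\<close>

lemma hermitian_diagonalization:
  fixes A :: "complex mat"
  assumes "A \<in> carrier_mat n n" "mat_adjoint A = A"
  shows "\<exists>U D. U \<in> unitary_group n \<and> D \<in> carrier_mat n n \<and> diagonal_mat D \<and>
    A = U * D * mat_adjoint U"
  using assms
proof (induction n arbitrary: A)
  case 0
  then show ?case
    by (intro exI[of _ "1\<^sub>m 0"] exI[of _ "1\<^sub>m 0"]) (auto simp: unitary_group_def diagonal_mat_def)
next
  case (Suc n)
  note A = Suc.prems(1) and herm = Suc.prems(2)
  obtain e where "eigenvalue A e" using spectrum_non_empty[OF A] by (auto simp: spectrum_def)
  then obtain v where v: "v \<in> carrier_vec (Suc n)" "v \<noteq> 0\<^sub>v (Suc n)" "A *\<^sub>v v = e \<cdot>\<^sub>v v"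
    using A unfolding eigenvalue_def eigenvector_def by auto
  obtain W c where W: "W \<in> unitary_group (Suc n)" "c \<noteq> 0" "col W 0 = c \<cdot>\<^sub>v v"
    using unitary_with_first_column[OF v(1,2)] .
  note Wu = unitary_groupD[OF W(1)]
  define A' where "A' = mat_adjoint W * A * W"
  have A': "A' \<in> carrier_mat (Suc n) (Suc n)" using A Wu unfolding A'_def by auto
  have herm': "mat_adjoint A' = A'"
    unfolding A'_def using A Wu(1) herm
    by (simp add: mat_adjoint_mult[of _ "Suc n" "Suc n" _ "Suc n"]
        assoc_mult_mat[of _ "Suc n" "Suc n" _ "Suc n" _ "Suc n"])
  have "col A' 0 = mat_adjoint W *\<^sub>v (A *\<^sub>v col W 0)"
    unfolding A'_def using A Wu(1)
    by (subst col_mult2[of _ "Suc n" "Suc n" _ "Suc n"])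
      (auto intro!: assoc_mult_mat_vec[of _ "Suc n" "Suc n" _ "Suc n"] carrier_vecI)
  also have "A *\<^sub>v col W 0 = e \<cdot>\<^sub>v col W 0"
    unfolding W(3) using A v by (simp add: mult_mat_vec smult_smult_assoc mult.commute)
  also have "mat_adjoint W *\<^sub>v (e \<cdot>\<^sub>v col W 0) = e \<cdot>\<^sub>v (col (mat_adjoint W * W) 0)"
    using Wu(1) by (subst col_mult2[of _ "Suc n" "Suc n" _ "Suc n"])
      (auto simp: mult_mat_vec[of _ "Suc n" "Suc n"])
  also have "\<dots> = e \<cdot>\<^sub>v unit_vec (Suc n) 0" unfolding Wu(2) by simp
  finally have col0: "col A' 0 = e \<cdot>\<^sub>v unit_vec (Suc n) 0" .
  have c0: "A' $$ (Suc i, 0) = 0" if "i < n" for i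
    using arg_cong[OF col0, of "\<lambda>x. x $ Suc i"] that A' by auto
  have r0: "A' $$ (0, Suc i) = 0" if "i < n" for i
    using arg_cong[OF herm', of "\<lambda>x. x $$ (0, Suc i)"] that A' c0[OF that] by auto
  define A3 where "A3 = mat n n (\<lambda>(i, j). A' $$ (Suc i, Suc j))"
  define E where "E = mat 1 1 (\<lambda>_. A' $$ (0, 0))"
  have split: "A' = four_block_mat E (0\<^sub>m 1 n) (0\<^sub>m n 1) A3"
    using A' c0 r0 by (intro eq_matI) (auto simp: A3_def E_def not_less less_Suc_eq_0_disj)
  have E: "E \<in> carrier_mat 1 1" unfolding E_def by auto
  have A3: "A3 \<in> carrier_mat n n" unfolding A3_def by auto
  have "mat_adjoint A3 = A3"
  proof (rule eq_matI)
    fix i j assume "i < dim_row A3" "j < dim_col A3"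
    thus "mat_adjoint A3 $$ (i, j) = A3 $$ (i, j)"
      using arg_cong[OF herm', of "\<lambda>x. x $$ (Suc i, Suc j)"] A' by (auto simp: A3_def)
  qed (auto simp: A3_def)
  from Suc.IH[OF A3 this] obtain U D where
    U: "U \<in> unitary_group n" and D: "D \<in> carrier_mat n n" "diagonal_mat D"
    and UD: "A3 = U * D * mat_adjoint U" by blast
  note Uu = unitary_groupD[OF U]
  let ?U = "four_block_mat (1\<^sub>m 1) (0\<^sub>m 1 n) (0\<^sub>m n 1) U"
  let ?D = "four_block_mat E (0\<^sub>m 1 n) (0\<^sub>m n 1) D"
  have adjU: "mat_adjoint ?U = four_block_mat (1\<^sub>m 1) (0\<^sub>m 1 n) (0\<^sub>m n 1) (mat_adjoint U)"
    using Uu(1) by (intro eq_matI) auto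
  have Uc: "?U \<in> carrier_mat (Suc n) (Suc n)" "?D \<in> carrier_mat (Suc n) (Suc n)"
    using Uu(1) D(1) E by auto
  have "mat_adjoint ?U * ?U = four_block_mat (1\<^sub>m 1) (0\<^sub>m 1 n) (0\<^sub>m n 1) (1\<^sub>m n)"
    unfolding adjU using Uu
    by (subst mult_four_block_mat[of _ 1 1 _ n _ n _ _ 1 _ n]) auto
  hence "mat_adjoint ?U * ?U = 1\<^sub>m (Suc n)" by simp
  hence U': "?U \<in> unitary_group (Suc n)" using Uc by (intro unitary_groupI) auto
  have D': "diagonal_mat ?D"
    using D E unfolding diagonal_mat_def by auto
  have z: "0\<^sub>m 1 n * U = 0\<^sub>m 1 n" "U * 0\<^sub>m n 1 = 0\<^sub>m n 1"
    if "U \<in> carrier_mat n n" for U :: "complex mat"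
    using that by auto
  have "?U * ?D = four_block_mat E (0\<^sub>m 1 n) (0\<^sub>m n 1) (U * D)"
    using mult_four_block_mat[OF one_carrier_mat[of 1] zero_carrier_mat[of 1 n] zero_carrier_mat[of n 1] Uu(1)
      E zero_carrier_mat[of 1 n] zero_carrier_mat[of n 1] D(1)] z E Uu(1) D(1)
    by (simp add: mult_carrier_mat[of _ n n _ n] del: One_nat_def)
  moreover have "\<dots> * mat_adjoint ?U = four_block_mat E (0\<^sub>m 1 n) (0\<^sub>m n 1) (U * D * mat_adjoint U)"
    unfolding adjU
    using mult_four_block_mat[OF E zero_carrier_mat[of 1 n] zero_carrier_mat[of n 1] mult_carrier_mat[OF Uu(1) D(1)]
      one_carrier_mat[of 1] zero_carrier_mat[of 1 n] zero_carrier_mat[of n 1] mat_adjoint_carrier[OF Uu(1)]]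
      z E Uu(1) D(1)
    by (simp add: mult_carrier_mat[of _ n n _ n] del: One_nat_def)
  ultimately have "A' = ?U * ?D * mat_adjoint ?U" unfolding split UD by simp
  \<comment> \<open>Undo the conjugation: the diagonalizing matrix of \<open>A\<close> is the
    product of \<open>W\<close> and the block matrix built from \<open>U\<close>.\<close>
  have "A = (W * mat_adjoint W) * A * (W * mat_adjoint W)" using A unfolding Wu(3) by simp
  also have "\<dots> = W * A' * mat_adjoint W"
    unfolding A'_def using A Wu(1)
    by (simp add: assoc_mult_mat[of _ "Suc n" "Suc n" _ "Suc n" _ "Suc n"]
        mult_carrier_mat[of _ "Suc n" "Suc n" _ "Suc n"])
  also have "\<dots> = (W * ?U) * ?D * mat_adjoint (W * ?U)"
    unfolding \<open>A' = ?U * ?D * mat_adjoint ?U\<close> using Wu(1) Uc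
    by (simp add: assoc_mult_mat[of _ "Suc n" "Suc n" _ "Suc n" _ "Suc n"]
        mat_adjoint_mult[of _ "Suc n" "Suc n" _ "Suc n"]
        mult_carrier_mat[of _ "Suc n" "Suc n" _ "Suc n"])
  finally show ?case using unitary_group_mult[OF W(1) U'] Uc(2) D' by blast
qed

section \<open>The positive semidefinite square root and the smallest singular value\<close>

lemma cscalar_prod_unitary:
  assumes "U \<in> unitary_group n" "v \<in> carrier_vec n"
  shows "(U *\<^sub>v v) \<bullet>c (U *\<^sub>v v) = v \<bullet>c v"
proof -
  note U = unitary_groupD[OF assms(1)]
  have "(U *\<^sub>v v) \<bullet>c (U *\<^sub>v v) = v \<bullet>c (mat_adjoint U *\<^sub>v (U *\<^sub>v v))"
    using U(1) assms(2) by (intro cscalar_prod_adjoint) auto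
  also have "mat_adjoint U *\<^sub>v (U *\<^sub>v v) = v"
    using U assms(2) by (simp flip: assoc_mult_mat_vec[of _ n n _ n])
  finally show ?thesis .
qed

text \<open>Rephrases the factorization through unit eigenvectors, the form in which the spectral
  theorem is applied to quadratic forms.\<close>

lemma diagonalization_column:
  fixes D :: "complex mat"
  assumes U: "U \<in> unitary_group n" and D: "D \<in> carrier_mat n n" "diagonal_mat D" and i: "i < n"
  shows "(U * D * mat_adjoint U) *\<^sub>v col U i = D $$ (i, i) \<cdot>\<^sub>v col U i"
    and "col U i \<in> carrier_vec n" "col U i \<bullet>c col U i = 1"
proof -
  note Uu = unitary_groupD[OF U]
  have colD: "col D i = D $$ (i, i) \<cdot>\<^sub>v unit_vec n i"
    using D i by (intro eq_vecI) (auto simp: diagonal_mat_def)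
  have colU: "U *\<^sub>v unit_vec n i = col U i"
    using Uu(1) i by (intro eq_vecI) auto
  have "(U * D * mat_adjoint U) *\<^sub>v col U i = (U * D) *\<^sub>v (mat_adjoint U *\<^sub>v col U i)"
    using Uu(1) D(1) i by (intro assoc_mult_mat_vec[of _ n n _ n]) auto
  also have "mat_adjoint U *\<^sub>v col U i = col (mat_adjoint U * U) i"
    using Uu(1) i by (subst col_mult2[of _ n n _ n]) auto
  also have "\<dots> = unit_vec n i" using i unfolding Uu(2) by simp
  also have "(U * D) *\<^sub>v unit_vec n i = col (U * D) i"
    using mult_carrier_mat[OF Uu(1) D(1)] i by (intro eq_vecI) auto
  also have "\<dots> = U *\<^sub>v col D i" using Uu(1) D(1) i by (subst col_mult2[of _ n n _ n]) auto
  also have "\<dots> = D $$ (i, i) \<cdot>\<^sub>v col U i"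
    unfolding colD using Uu(1) i by (simp add: mult_mat_vec[of _ n n] colU)
  finally show "(U * D * mat_adjoint U) *\<^sub>v col U i = D $$ (i, i) \<cdot>\<^sub>v col U i" .
  show "col U i \<in> carrier_vec n" using Uu(1) by auto
  have "col U i \<bullet>c col U i = unit_vec n i \<bullet>c (unit_vec n i :: complex vec)"
    using cscalar_prod_unitary[OF U, of "unit_vec n i"] colU by simp
  also have "\<dots> = 1" using i by simp
  finally show "col U i \<bullet>c col U i = 1" .
qed

definition diag_real :: "nat \<Rightarrow> (nat \<Rightarrow> real) \<Rightarrow> complex mat" where
  "diag_real n f = mat n n (\<lambda>(i, j). if i = j then complex_of_real (f i) else 0)"

lemma diag_real_carrier [simp]: "diag_real n f \<in> carrier_mat n n"
  unfolding diag_real_def by simp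

lemma diag_real_mult: "diag_real n f * diag_real n g = diag_real n (\<lambda>i. f i * g i)"
  unfolding diag_real_def
  by (intro eq_matI) (auto simp: scalar_prod_def if_distrib[of "\<lambda>x. x * _"] sum.delta cong: if_cong)

lemma mat_adjoint_diag_real [simp]: "mat_adjoint (diag_real n f) = diag_real n f"
  unfolding diag_real_def by (intro eq_matI) auto

text \<open>The quadratic form at \<open>v\<close> is the squared length of
  \<open>mat_adjoint T\<close> applied to \<open>v\<close>.\<close>

lemma pos_semidef_mult_adjoint:
  assumes "T \<in> carrier_mat n n"
  shows "pos_semidef_mat (T * mat_adjoint T)"
  unfolding pos_semidef_mat_def
proof (intro conjI ballI)
  note T = assms
  show "square_mat (T * mat_adjoint T)" using T by simp
  show "mat_adjoint (T * mat_adjoint T) = T * mat_adjoint T"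
    using T by (subst mat_adjoint_mult[of _ n n _ n]) auto
  fix v :: "complex vec" assume "v \<in> carrier_vec (dim_row (T * mat_adjoint T))"
  hence v: "v \<in> carrier_vec n" using T by simp
  hence "(T * mat_adjoint T *\<^sub>v v) \<bullet>c v = (mat_adjoint T *\<^sub>v v) \<bullet>c (mat_adjoint T *\<^sub>v v)"
    using T cscalar_prod_adjoint[OF T mult_mat_vec_carrier[OF mat_adjoint_carrier[OF T]], of v v]
    by (simp add: assoc_mult_mat_vec[of _ n n _ n])
  thus "0 \<le> Re ((T * mat_adjoint T *\<^sub>v v) \<bullet>c v)"
    by (simp add: cscalar_prod_self sum_nonneg)
qed

text \<open>Diagonalize \<open>B\<close> and take square roots of the eigenvalues.\<close>

lemma pos_semidef_sqrt_exists:
  assumes B: "pos_semidef_mat B" "B \<in> carrier_mat n n"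
  shows "\<exists>P. pos_semidef_mat P \<and> P * P = B"
proof -
  have herm: "mat_adjoint B = B" using B(1) unfolding pos_semidef_mat_def by simp
  obtain U D where U: "U \<in> unitary_group n" and D: "D \<in> carrier_mat n n" "diagonal_mat D"
    and BUD: "B = U * D * mat_adjoint U"
    using hermitian_diagonalization[OF B(2) herm] by blast
  note Uu = unitary_groupD[OF U]
  note col = diagonalization_column[OF U D, folded BUD]
  \<comment> \<open>Each diagonal entry is the quadratic form of \<open>B\<close> at a unit
    eigenvector: real because \<open>B\<close> is Hermitian, nonnegative because \<open>B\<close> is
    positive semidefinite.\<close>
  have Dii: "0 \<le> Re (D $$ (i, i)) \<and> Im (D $$ (i, i)) = 0" if i: "i < n" for i
  proof -
    have 1: "(B *\<^sub>v col U i) \<bullet>c col U i = D $$ (i, i)"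
      using col[OF i] by simp
    have "D $$ (i, i) = col U i \<bullet>c (B *\<^sub>v col U i)"
      using cscalar_prod_adjoint[OF B(2) col(2)[OF i] col(2)[OF i]] herm 1 by simp
    also have "\<dots> = cnj (D $$ (i, i))"
      using col[OF i] by (simp add: conjugate_smult_vec)
    finally have "Im (D $$ (i, i)) = 0" by (simp add: complex_eq_iff)
    moreover have "0 \<le> Re ((B *\<^sub>v col U i) \<bullet>c col U i)"
      using B col(2)[OF i] unfolding pos_semidef_mat_def by auto
    ultimately show ?thesis using 1 by simp
  qed
  define f where "f i = sqrt (Re (D $$ (i, i)))" for i
  define G where "G = diag_real n f"
  \<comment> \<open>\<open>F\<close> holds the fourth roots of the eigenvalues of \<open>B\<close>.
    It exhibits \<open>P\<close> as \<open>U * F\<close> times its adjoint, which yields positivity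
    of \<open>P\<close>.\<close>
  define F where "F = diag_real n (\<lambda>i. sqrt (f i))"
  have G: "G \<in> carrier_mat n n" and F: "F \<in> carrier_mat n n" "mat_adjoint F = F"
    unfolding G_def F_def by auto
  have GG: "G * G = D"
    unfolding G_def diag_real_mult using D Dii
    by (intro eq_matI) (auto simp: diag_real_def f_def diagonal_mat_def complex_eq_iff)
  have FF: "F * F = G"
    unfolding F_def G_def diag_real_mult using Dii
    by (intro eq_matI) (auto simp: diag_real_def f_def simp flip: of_real_mult)
  define P where "P = U * G * mat_adjoint U"
  have "P = (U * F) * mat_adjoint (U * F)"
    unfolding P_def FF[symmetric] using Uu(1) F
    by (simp add: mat_adjoint_mult[of _ n n _ n] assoc_mult_mat[of _ n n _ n _ n]
        mult_carrier_mat[of _ n n _ n])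
  hence "pos_semidef_mat P"
    using pos_semidef_mult_adjoint[of "U * F" n] Uu(1) F(1) mult_carrier_mat[of U n n F n] by simp
  moreover have "P * P = U * (G * (mat_adjoint U * U) * G) * mat_adjoint U"
    unfolding P_def using Uu(1) G
    by (simp add: assoc_mult_mat[of _ n n _ n _ n] mult_carrier_mat[of _ n n _ n])
  hence "P * P = B"
    unfolding Uu(2) BUD using G GG by simp
  ultimately show ?thesis by blast
qed

lemma hermitian_eq_0:
  assumes A: "A \<in> carrier_mat n n" "mat_adjoint A = A"
    and ev: "\<And>v e. v \<in> carrier_vec n \<Longrightarrow> v \<bullet>c v = 1 \<Longrightarrow> A *\<^sub>v v = e \<cdot>\<^sub>v v \<Longrightarrow> e = (0 :: complex)"
  shows "A = 0\<^sub>m n n"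
proof -
  obtain U D where U: "U \<in> unitary_group n" and D: "D \<in> carrier_mat n n" "diagonal_mat D"
    and UD: "A = U * D * mat_adjoint U"
    using hermitian_diagonalization[OF A] by blast
  have "D $$ (i, i) = 0" if "i < n" for i
    using ev[of "col U i" "D $$ (i, i)"] diagonalization_column[OF U D that] UD by simp
  hence "D = 0\<^sub>m n n"
    using D unfolding diagonal_mat_def by (intro eq_matI) (simp_all, metis)
  thus ?thesis using unitary_groupD(1)[OF U] by (simp add: UD)
qed

text \<open>With \<open>C = P - Q\<close>, the equation \<open>P\<^sup>2 = Q\<^sup>2\<close> reads \<open>P C + C Q = 0\<close>.
  A unit eigenvector of \<open>C\<close> with eigenvalue \<open>e \<noteq> 0\<close> then has
  \<open>\<langle>P v, v\<rangle> + \<langle>Q v, v\<rangle> = 0\<close>, so both terms vanish and \<open>e = \<langle>C v, v\<rangle> = 0\<close>.\<close>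

lemma pos_semidef_sqrt_unique:
  assumes P: "pos_semidef_mat P" "P \<in> carrier_mat n n"
    and Q: "pos_semidef_mat Q" "Q \<in> carrier_mat n n"
    and eq: "P * P = Q * Q"
  shows "P = Q"
proof -
  define C where "C = P - Q"
  have adj: "mat_adjoint P = P" "mat_adjoint Q = Q"
    using P Q unfolding pos_semidef_mat_def by auto
  have C: "C \<in> carrier_mat n n" using P Q unfolding C_def by auto
  have "mat_adjoint C $$ (i, j) = C $$ (i, j)" if "i < n" "j < n" for i j
    using arg_cong[OF adj(1), of "\<lambda>x. x $$ (i, j)"] arg_cong[OF adj(2), of "\<lambda>x. x $$ (i, j)"]
      that P(2) Q(2) by (auto simp: C_def)
  hence Cadj: "mat_adjoint C = C" using C by (intro eq_matI) auto
  have "C = 0\<^sub>m n n"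
  proof (rule hermitian_eq_0[OF C Cadj])
    fix v e assume v: "v \<in> carrier_vec n" "v \<bullet>c v = 1" and Cv: "C *\<^sub>v v = e \<cdot>\<^sub>v v"
    define p q where "p = (P *\<^sub>v v) \<bullet>c v" and "q = (Q *\<^sub>v v) \<bullet>c v"
    have real: "Im z = 0" if "M \<in> carrier_mat n n" "mat_adjoint M = M" "z = (M *\<^sub>v v) \<bullet>c v" for M z
    proof -
      have "z = v \<bullet>c (M *\<^sub>v v)" using cscalar_prod_adjoint[OF that(1) v(1) v(1)] that by simp
      also have "\<dots> = cnj z"
        using that v by (auto simp: scalar_prod_def mult.commute intro!: sum.cong)
      finally show ?thesis by (simp add: complex_eq_iff)
    qed
    have pq0: "Re p \<ge> 0" "Re q \<ge> 0" "Im p = 0" "Im q = 0"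
      using P Q v real[OF P(2) adj(1) p_def] real[OF Q(2) adj(2) q_def]
      unfolding pos_semidef_mat_def p_def q_def by auto
    have Cvv: "P *\<^sub>v v - Q *\<^sub>v v = e \<cdot>\<^sub>v v"
      using Cv P(2) Q(2) v(1) unfolding C_def by (simp add: minus_mult_distrib_mat_vec)
    have "p - q = (P *\<^sub>v v - Q *\<^sub>v v) \<bullet>c v"
      unfolding p_def q_def using P(2) Q(2) v(1) by (subst minus_scalar_prod_distrib[of _ n]) auto
    hence e: "e = p - q" using v unfolding Cvv by simp
    \<comment> \<open>With angle brackets for the inner product,
      \<open><C Q v, v> = <Q v, C v>\<close> is expanded first and \<open><P C v, v>\<close> next.
      Their sum cancels because \<open>P P = Q Q\<close> and because \<open>P\<close> can be moved
      across the inner product.\<close>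
    have "(Q *\<^sub>v v) \<bullet>c (e \<cdot>\<^sub>v v) = (Q *\<^sub>v v) \<bullet>c (P *\<^sub>v v) - (Q *\<^sub>v v) \<bullet>c (Q *\<^sub>v v)"
      unfolding Cvv[symmetric] using P(2) Q(2) v(1)
      by (auto simp: scalar_prod_def sum_subtractf algebra_simps)
    moreover have "(P *\<^sub>v (e \<cdot>\<^sub>v v)) \<bullet>c v = (P *\<^sub>v (P *\<^sub>v v)) \<bullet>c v - (P *\<^sub>v (Q *\<^sub>v v)) \<bullet>c v"
      unfolding Cvv[symmetric] using P(2) Q(2) v(1)
      by (subst mult_minus_distrib_mat_vec[of _ n n], auto)
        (subst minus_scalar_prod_distrib[of _ n], auto)
    moreover have "(P *\<^sub>v (Q *\<^sub>v v)) \<bullet>c v = (Q *\<^sub>v v) \<bullet>c (P *\<^sub>v v)"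
      using cscalar_prod_adjoint[OF P(2), of "Q *\<^sub>v v" v] adj v Q(2) by simp
    moreover have "(P *\<^sub>v (P *\<^sub>v v)) \<bullet>c v = (Q *\<^sub>v v) \<bullet>c (Q *\<^sub>v v)"
    proof -
      have "P *\<^sub>v (P *\<^sub>v v) = Q *\<^sub>v (Q *\<^sub>v v)"
        using assoc_mult_mat_vec[OF P(2) P(2) v(1)] assoc_mult_mat_vec[OF Q(2) Q(2) v(1)] eq by simp
      thus ?thesis using cscalar_prod_adjoint[OF Q(2), of "Q *\<^sub>v v" v] adj v Q(2) by simp
    qed
    moreover have "(P *\<^sub>v (e \<cdot>\<^sub>v v)) \<bullet>c v = e * p"
      unfolding p_def using P(2) v by (simp add: mult_mat_vec[of _ n n])
    moreover have "(Q *\<^sub>v v) \<bullet>c (e \<cdot>\<^sub>v v) = cnj e * q"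
      unfolding q_def using Q(2) v by (simp add: conjugate_smult_vec)
    ultimately have "e * p + cnj e * q = 0" by simp
    moreover have "cnj e = e" unfolding e using pq0 by (simp add: complex_eq_iff)
    ultimately have "e * (p + q) = 0" by (simp add: algebra_simps)
    thus "e = 0" using pq0 unfolding e by (auto simp: complex_eq_iff)
  qed
  hence "(P - Q) $$ (i, j) = 0" if "i < n" "j < n" for i j
    using that unfolding C_def by simp
  thus ?thesis using P(2) Q(2) by (intro eq_matI) auto
qed

lemma mat_sqrt_pos_semidef:
  assumes "pos_semidef_mat B" "B \<in> carrier_mat n n"
  shows "pos_semidef_mat (mat_sqrt B)" "mat_sqrt B * mat_sqrt B = B" "mat_sqrt B \<in> carrier_mat n n"
proof -
  \<comment> \<open>The description in \<open>mat_sqrt\<close> ranges over matrices of every size.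
    The equation \<open>P * P = B\<close> fixes the number of rows, and squareness then the number
    of columns.\<close>
  have carr: "P \<in> carrier_mat n n" if "pos_semidef_mat P" "P * P = B" for P
  proof
    show "dim_row P = n" using arg_cong[OF that(2), of dim_row] assms by simp
    thus "dim_col P = n" using that(1) unfolding pos_semidef_mat_def by simp
  qed
  have "\<exists>!P. pos_semidef_mat P \<and> P * P = B"
    using pos_semidef_sqrt_exists[OF assms] pos_semidef_sqrt_unique carr by metis
  hence "pos_semidef_mat (mat_sqrt B) \<and> mat_sqrt B * mat_sqrt B = B"
    unfolding mat_sqrt_def by (rule theI')
  thus "pos_semidef_mat (mat_sqrt B)" "mat_sqrt B * mat_sqrt B = B" "mat_sqrt B \<in> carrier_mat n n"
    using carr by auto
qed

text \<open>Take an eigenvector \<open>v\<close> of the root \<open>P\<close> of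
  \<open>mat_adjoint A * A\<close> for the eigenvalue \<open>s_min A\<close>. Since \<open>P\<close>
  is Hermitian, \<open>A v\<close> and \<open>P v\<close> have the same length.\<close>

lemma s_min_attained:
  assumes A: "A \<in> carrier_mat n n" and n: "n > 0"
  obtains v where "v \<in> carrier_vec n" "v \<noteq> 0\<^sub>v n" "s_min A \<ge> 0"
    "(A *\<^sub>v v) \<bullet>c (A *\<^sub>v v) = complex_of_real ((s_min A)\<^sup>2) * (v \<bullet>c v)"
proof -
  let ?B = "mat_adjoint A * A"
  define P where "P = mat_sqrt ?B"
  have B: "pos_semidef_mat ?B" "?B \<in> carrier_mat n n"
    using pos_semidef_mult_adjoint[of "mat_adjoint A" n] A by auto
  note P = mat_sqrt_pos_semidef[OF B, folded P_def]
  have adj: "mat_adjoint P = P" using P(1) unfolding pos_semidef_mat_def by simp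
  let ?S = "{s :: real. eigenvalue P (complex_of_real s)}"
  have ev: "e \<in> \<real>" "Re e \<ge> 0" if e: "P *\<^sub>v v = e \<cdot>\<^sub>v v" and v: "v \<in> carrier_vec n" "v \<noteq> 0\<^sub>v n" for e v
  proof -
    have v0: "v \<bullet>c v \<noteq> 0" "Re (v \<bullet>c v) > 0" "Im (v \<bullet>c v) = 0"
      using v conjugate_square_greater_0_vec[OF v(1)] by (auto simp: less_complex_def)
    have 1: "(P *\<^sub>v v) \<bullet>c v = e * (v \<bullet>c v)" unfolding e using v by simp
    moreover have "(P *\<^sub>v v) \<bullet>c v = cnj e * (v \<bullet>c v)"
      using cscalar_prod_adjoint[OF P(3) v(1) v(1)] v by (simp add: adj e conjugate_smult_vec)
    ultimately have "e = cnj e" using v0 by simp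
    thus real: "e \<in> \<real>" by (simp add: complex_eq_iff complex_is_Real_iff)
    have "Re ((P *\<^sub>v v) \<bullet>c v) \<ge> 0" using P(1,3) v(1) unfolding pos_semidef_mat_def by auto
    thus "Re e \<ge> 0" using v0 unfolding 1 by (auto simp: zero_le_mult_iff)
  qed
  have evP: "\<exists>v. v \<in> carrier_vec n \<and> v \<noteq> 0\<^sub>v n \<and> P *\<^sub>v v = e \<cdot>\<^sub>v v" if "eigenvalue P e" for e
    using that P(3) unfolding eigenvalue_def eigenvector_def by auto
  obtain e where e: "eigenvalue P e"
    using spectrum_non_empty[OF P(3) n] by (auto simp: spectrum_def)
  \<comment> \<open>Some complex eigenvalue exists as \<open>n > 0\<close>. Being real, it belongs
    to \<open>?S\<close>, so \<open>Min\<close> is taken over a nonempty set; finiteness comes from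
    the spectrum.\<close>
  hence "of_real (Re e) = e" using evP ev by (metis of_real_Re)
  hence "Re e \<in> ?S" using e by simp
  moreover have "finite ?S"
    using finite_vimageI[OF card_finite_spectrum(1)[OF P(3)], of complex_of_real]
    by (auto simp: spectrum_def vimage_def inj_def)
  ultimately have "Min ?S \<in> ?S" by (intro Min_in) auto
  hence "eigenvalue P (complex_of_real (s_min A))" unfolding s_min_def P_def[symmetric] by simp
  then obtain v where v: "v \<in> carrier_vec n" "v \<noteq> 0\<^sub>v n" and Pv: "P *\<^sub>v v = complex_of_real (s_min A) \<cdot>\<^sub>v v"
    using evP by blast
  have "s_min A \<ge> 0" using ev(2)[OF Pv v] by simp
  moreover have "(A *\<^sub>v v) \<bullet>c (A *\<^sub>v v) = v \<bullet>c (mat_adjoint A *\<^sub>v (A *\<^sub>v v))"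
    using A v by (intro cscalar_prod_adjoint) auto
  moreover have "mat_adjoint A *\<^sub>v (A *\<^sub>v v) = P *\<^sub>v (P *\<^sub>v v)"
    using A P(3) v(1) by (simp add: P(2) flip: assoc_mult_mat_vec[of _ n n _ n])
  moreover have "v \<bullet>c (P *\<^sub>v (P *\<^sub>v v)) = (P *\<^sub>v v) \<bullet>c (P *\<^sub>v v)"
    using cscalar_prod_adjoint[OF P(3) v(1), of "P *\<^sub>v v"] P(3) v(1) adj by simp
  moreover have "\<dots> = complex_of_real ((s_min A)\<^sup>2) * (v \<bullet>c v)"
    unfolding Pv using v(1) by (simp add: conjugate_smult_vec power2_eq_square)
  ultimately show thesis using that v by metis
qed

section \<open>Rotations about a vector and the resolvent\<close>

definition norm_sq :: "complex vec \<Rightarrow> real" where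
  "norm_sq v = (\<Sum>i<dim_vec v. (cmod (v $ i))\<^sup>2)"

lemma cscalar_prod_norm_sq: "v \<bullet>c v = complex_of_real (norm_sq v)"
  unfolding norm_sq_def by (rule cscalar_prod_self)

lemma norm_sq_nonneg: "norm_sq v \<ge> 0"
  unfolding norm_sq_def by (simp add: sum_nonneg)

lemma norm_sq_pos:
  assumes "v \<in> carrier_vec n" "v \<noteq> 0\<^sub>v n"
  shows "norm_sq v > 0"
  using conjugate_square_greater_0_vec[OF assms(1)] assms(2)
  by (simp add: cscalar_prod_norm_sq less_complex_def)

lemma norm_sq_unitary:
  assumes "U \<in> unitary_group n" "v \<in> carrier_vec n"
  shows "norm_sq (U *\<^sub>v v) = norm_sq v"
  using cscalar_prod_unitary[OF assms] by (simp add: cscalar_prod_norm_sq)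

text \<open>This is the identity plus \<open>z - 1\<close> times the orthogonal projection onto the
  line of \<open>v\<close>. Dividing by the squared length allows \<open>v\<close> of any length;
  for \<open>v = 0\<close> division by zero makes it the identity.\<close>

definition rotation :: "nat \<Rightarrow> complex vec \<Rightarrow> complex \<Rightarrow> complex mat" where
  "rotation n v z =
     mat n n (\<lambda>(i, j). of_bool (i = j) + (z - 1) / (v \<bullet>c v) * v $ i * cnj (v $ j))"

lemma rotation_carrier [simp]: "rotation n v z \<in> carrier_mat n n"
  unfolding rotation_def by simp

text \<open>With \<open>T\<close> the rank-one matrix of \<open>v\<close> and \<open>s\<close> its
  squared length, \<open>T T = s T\<close>. Hence \<open>1 + a T\<close> times
  \<open>1 + b T\<close> is \<open>1 + (a + b + a b s) T\<close>.\<close>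

lemma rotation_mult:
  assumes v: "v \<in> carrier_vec n" "v \<noteq> 0\<^sub>v n"
  shows "rotation n v z * rotation n v w = rotation n v (z * w)"
proof (rule eq_matI)
  fix i j assume "i < dim_row (rotation n v (z * w))" "j < dim_col (rotation n v (z * w))"
  hence ij: "i < n" "j < n" by (auto simp: rotation_def)
  define s where "s = v \<bullet>c v"
  have s: "s = (\<Sum>k<n. cnj (v $ k) * v $ k)"
    using v(1) unfolding s_def by (auto simp: scalar_prod_def atLeast0LessThan mult.commute)
  have s0: "s \<noteq> 0" using v unfolding s_def by simp
  define a b where "a = (z - 1) / s" and "b = (w - 1) / s"
  have "(rotation n v z * rotation n v w) $$ (i, j) =
      (\<Sum>k<n. (of_bool (i = k) + a * v $ i * cnj (v $ k)) * (of_bool (k = j) + b * v $ k * cnj (v $ j)))"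
    using ij by (simp add: rotation_def scalar_prod_def atLeast0LessThan a_def b_def s_def)
  also have "\<dots> = (\<Sum>k<n. (if k = i then of_bool (i = j) + b * v $ i * cnj (v $ j) else 0)
      + (if k = j then a * v $ i * cnj (v $ j) else 0)
      + a * b * v $ i * cnj (v $ j) * (cnj (v $ k) * v $ k))"
    by (rule sum.cong) (auto simp: algebra_simps)
  also have "\<dots> = of_bool (i = j) + (a + b + a * b * s) * v $ i * cnj (v $ j)"
    using ij by (simp add: sum.distrib s sum_distrib_left algebra_simps)
  also have "a + b + a * b * s = (z * w - 1) / s"
    using s0 by (simp add: a_def b_def field_simps)
  finally show "(rotation n v z * rotation n v w) $$ (i, j) = rotation n v (z * w) $$ (i, j)"
    using ij by (simp add: rotation_def s_def)
qed (auto simp: rotation_def)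

lemma rotation_one: "rotation n v 1 = 1\<^sub>m n"
  unfolding rotation_def by (rule eq_matI) auto

lemma mat_adjoint_rotation:
  "mat_adjoint (rotation n v z) = rotation n v (cnj z)"
proof -
  have "cnj (v \<bullet>c v) = v \<bullet>c v" by (simp add: cscalar_prod_norm_sq)
  thus ?thesis
    unfolding rotation_def by (intro eq_matI) (auto simp: mult_ac)
qed

lemma rotation_unitary:
  assumes v: "v \<in> carrier_vec n" "v \<noteq> 0\<^sub>v n" and z: "cmod z = 1"
  shows "rotation n v z \<in> unitary_group n"
proof (rule unitary_groupI)
  have "cnj z * z = 1"
    using z complex_norm_square[of z] by (simp add: mult.commute)
  thus "mat_adjoint (rotation n v z) * rotation n v z = 1\<^sub>m n"
    using v by (simp add: mat_adjoint_rotation rotation_mult rotation_one)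
qed simp

lemma rotation_mult_vec:
  assumes v: "v \<in> carrier_vec n" and y: "y \<in> carrier_vec n"
  shows "rotation n v z *\<^sub>v y = y + ((z - 1) / (v \<bullet>c v) * (y \<bullet>c v)) \<cdot>\<^sub>v v"
proof (rule eq_vecI)
  fix i assume "i < dim_vec (y + ((z - 1) / (v \<bullet>c v) * (y \<bullet>c v)) \<cdot>\<^sub>v v)"
  hence i: "i < n" using v y by simp
  have "(rotation n v z *\<^sub>v y) $ i =
      (\<Sum>k<n. (of_bool (i = k) + (z - 1) / (v \<bullet>c v) * v $ i * cnj (v $ k)) * y $ k)"
    using i y by (simp add: rotation_def scalar_prod_def atLeast0LessThan)
  also have "\<dots> = (\<Sum>k<n. (if k = i then y $ i else 0) + (z - 1) / (v \<bullet>c v) * v $ i * (y $ k * cnj (v $ k)))"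
    by (rule sum.cong) (auto simp: algebra_simps)
  also have "\<dots> = y $ i + (z - 1) / (v \<bullet>c v) * v $ i * (y \<bullet>c v)"
    using i v y by (simp add: sum.distrib scalar_prod_def[of y] atLeast0LessThan sum_distrib_left sum_divide_distrib)
  finally show "(rotation n v z *\<^sub>v y) $ i = (y + ((z - 1) / (v \<bullet>c v) * (y \<bullet>c v)) \<cdot>\<^sub>v v) $ i"
    using i v y by simp
qed (use v y in \<open>auto simp: rotation_def\<close>)

section \<open>The resolvent and its behaviour under rotations\<close>

lemma smult_mat_mult_vec:
  fixes A :: "'a :: comm_ring_1 mat"
  assumes "A \<in> carrier_mat nr nc" "v \<in> carrier_vec nc"
  shows "(c \<cdot>\<^sub>m A) *\<^sub>v v = c \<cdot>\<^sub>v (A *\<^sub>v v)"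
  using assms by (intro eq_vecI) (auto simp: scalar_prod_def sum_distrib_left mult.assoc)

text \<open>This is \<open>U (D + U)^-1\<close> written with Cramer's rule, so that its entries are
  visibly measurable functions of \<open>U\<close>. When \<open>D + U\<close> is singular, the
  factor \<open>1 / 0 = 0\<close> makes it the zero matrix.\<close>

definition resolvent :: "complex mat \<Rightarrow> complex mat \<Rightarrow> complex mat" where
  "resolvent D U = (1 / det (D + U)) \<cdot>\<^sub>m (U * adj_mat (D + U))"

context
  fixes n :: nat and D U :: "complex mat"
  assumes D: "D \<in> carrier_mat n n" and U: "U \<in> carrier_mat n n"
    and det: "det (D + U) \<noteq> 0"
begin

lemma resolvent_carrier: "resolvent D U \<in> carrier_mat n n"
  using D U adj_mat(1)[of "D + U" n] unfolding resolvent_def by simp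

lemma resolvent_mult: "resolvent D U * (D + U) = U"
proof -
  have DU: "D + U \<in> carrier_mat n n" using D U by simp
  note adj = adj_mat[OF DU]
  have "resolvent D U * (D + U) = (1 / det (D + U)) \<cdot>\<^sub>m (U * (adj_mat (D + U) * (D + U)))"
    unfolding resolvent_def using U DU adj(1)
    by (simp add: assoc_mult_mat[of _ n n _ n _ n] mult_smult_assoc_mat[of _ n n _ n] mult_carrier_mat[of _ n n _ n])
  also have "\<dots> = U"
    unfolding adj(3) using U det by (intro eq_matI) (auto simp: mult_smult_distrib[of _ n n _ n])
  finally show ?thesis .
qed

lemma resolvent_mult_vec:
  assumes "x \<in> carrier_vec n"
  shows "resolvent D U *\<^sub>v ((D + U) *\<^sub>v x) = U *\<^sub>v x"
  using assoc_mult_mat_vec[OF resolvent_carrier _ assms, of "D + U"] D U by (simp add: resolvent_mult)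

lemma solution_exists:
  assumes v: "v \<in> carrier_vec n"
  obtains x where "x \<in> carrier_vec n" "(D + U) *\<^sub>v x = v"
proof -
  have DU: "D + U \<in> carrier_mat n n" using D U by simp
  note adj = adj_mat[OF DU]
  let ?x = "(1 / det (D + U)) \<cdot>\<^sub>v (adj_mat (D + U) *\<^sub>v v)"
  have "(D + U) *\<^sub>v ?x = (1 / det (D + U)) \<cdot>\<^sub>v (((D + U) * adj_mat (D + U)) *\<^sub>v v)"
    using DU v adj(1) by (simp add: mult_mat_vec[of _ n n] assoc_mult_mat_vec[of _ n n _ n])
  also have "\<dots> = v"
    unfolding adj(2) using v det
    by (intro eq_vecI) (auto simp: smult_mat_mult_vec[of _ n n])
  finally show thesis using that[of ?x] mult_mat_vec_carrier[OF adj(1) v] by simp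
qed

lemma solution_unique:
  assumes "x \<in> carrier_vec n" "y \<in> carrier_vec n" "(D + U) *\<^sub>v x = (D + U) *\<^sub>v y"
  shows "x = y"
proof -
  have DU: "D + U \<in> carrier_mat n n" using D U by simp
  note adj = adj_mat[OF DU]
  have "(1 / det (D + U)) \<cdot>\<^sub>v (adj_mat (D + U) *\<^sub>v ((D + U) *\<^sub>v z)) = z" if z: "z \<in> carrier_vec n" for z
    using assoc_mult_mat_vec[OF adj(1) DU z, symmetric] z det
    unfolding adj(3) by (simp add: smult_mat_mult_vec[of _ n n] smult_smult_assoc)
  thus ?thesis using assms by metis
qed

end

text \<open>Left multiplication of \<open>U\<close> by a rotation about \<open>v\<close> is a rank-one perturbation in the direction \<open>v\<close>;
  the quadratic form at \<open>v\<close> transforms by a Moebius map.\<close>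

lemma resolvent_rotation:
  fixes z :: complex
  assumes D: "D \<in> carrier_mat n n" and U: "U \<in> carrier_mat n n"
    and v: "v \<in> carrier_vec n" "v \<noteq> 0\<^sub>v n"
    and det: "det (D + U) \<noteq> 0" "det (D + rotation n v z * U) \<noteq> 0"
  defines "q \<equiv> (resolvent D U *\<^sub>v v) \<bullet>c v"
    and "q' \<equiv> (resolvent D (rotation n v z * U) *\<^sub>v v) \<bullet>c v"
  shows "q' = (z - (z - 1) * q' / (v \<bullet>c v)) * q"
proof -
  define s where "s = v \<bullet>c v"
  have s: "s \<noteq> 0" using v unfolding s_def by simp
  let ?R = "rotation n v z"
  have RU: "?R * U \<in> carrier_mat n n" using mult_carrier_mat[OF rotation_carrier U] .
  \<comment> \<open>Both quadratic forms are read off from solutions of linear systems with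
    right-hand side \<open>v\<close>, since the resolvent sends \<open>v\<close> to
    \<open>U x\<close> and to \<open>?R * U * y\<close> respectively.\<close>
  obtain x where x: "x \<in> carrier_vec n" "(D + U) *\<^sub>v x = v"
    using solution_exists[OF D U det(1) v(1)] .
  obtain y where y: "y \<in> carrier_vec n" "(D + ?R * U) *\<^sub>v y = v"
    using solution_exists[OF D RU det(2) v(1)] .
  have q: "q = (U *\<^sub>v x) \<bullet>c v"
    using resolvent_mult_vec[OF D U det(1) x(1)] unfolding x(2) q_def by simp
  define b where "b = (U *\<^sub>v y) \<bullet>c v"
  have Uy: "U *\<^sub>v y \<in> carrier_vec n" using U y by auto
  have RUy: "(?R * U) *\<^sub>v y = U *\<^sub>v y + ((z - 1) / s * b) \<cdot>\<^sub>v v"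
    using rotation_mult_vec[OF v(1) Uy, of z] U y
    by (simp add: s_def b_def assoc_mult_mat_vec[of _ n n _ n])
  have "q' = ((?R * U) *\<^sub>v y) \<bullet>c v"
    using resolvent_mult_vec[OF D RU det(2) y(1)] unfolding y(2) q'_def by simp
  also have "\<dots> = b + (z - 1) / s * b * s"
    unfolding RUy using Uy v(1) by (simp add: add_scalar_prod_distrib[of _ n] b_def s_def)
  finally have q': "q' = z * b" using s by (simp add: field_simps)
  define w where "w = (z - 1) / s * b"
  define c where "c = 1 - w"
  \<comment> \<open>The rotation changes \<open>(D + U) y\<close> only by a multiple of
    \<open>v\<close>, and \<open>(D + ?R * U) y\<close> is \<open>v\<close> itself. Hence
    \<open>y\<close> is a multiple of \<open>x\<close>.\<close>
  have "(D + U) *\<^sub>v y = c \<cdot>\<^sub>v v"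
  proof (rule eq_vecI)
    fix i assume "i < dim_vec (c \<cdot>\<^sub>v v)"
    hence i: "i < n" using v by simp
    have "(D + ?R * U) *\<^sub>v y = D *\<^sub>v y + (U *\<^sub>v y + ((z - 1) / s * b) \<cdot>\<^sub>v v)"
      using add_mult_distrib_mat_vec[OF D RU y(1)] RUy by simp
    from arg_cong[OF this, of "\<lambda>w. w $ i"]
    have "v $ i = (D *\<^sub>v y) $ i + (U *\<^sub>v y) $ i + w * v $ i"
      unfolding y(2) using i D U v y by (simp add: w_def add.assoc)
    moreover have "((D + U) *\<^sub>v y) $ i = (D *\<^sub>v y) $ i + (U *\<^sub>v y) $ i"
      using add_mult_distrib_mat_vec[OF D U y(1)] i D U by simp
    ultimately show "((D + U) *\<^sub>v y) $ i = (c \<cdot>\<^sub>v v) $ i"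
      using i v unfolding c_def by (simp add: algebra_simps)
  qed (use D U v in auto)
  also have "\<dots> = (D + U) *\<^sub>v (c \<cdot>\<^sub>v x)"
    using x D U by (simp add: mult_mat_vec[of _ n n])
  finally have "y = c \<cdot>\<^sub>v x"
    using solution_unique[OF D U det(1) y(1)] x(1) by simp
  hence "b = c * q"
    unfolding b_def q using U x(1) v(1) by (simp add: mult_mat_vec[of _ n n])
  hence "z * b = z * c * q" by simp
  also have "z * c = z - (z - 1) * (z * b) / s"
    unfolding c_def w_def by (simp add: algebra_simps)
  finally have "z * b = (z - (z - 1) * (z * b) / s) * q" .
  thus ?thesis unfolding q' s_def .
qed

text \<open>Dividing the Moebius relation by both quadratic forms \<open>a\<close> and
  \<open>b\<close> turns it into \<open>(z - 1) / s = z / b - 1 / a\<close>. If both forms exceed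
  \<open>K s\<close> in modulus, the right-hand side is smaller than
  \<open>2 / (K s)\<close>.\<close>

lemma resolvent_rotation_separation:
  fixes z :: complex
  assumes D: "D \<in> carrier_mat n n" and U: "U \<in> carrier_mat n n"
    and v: "v \<in> carrier_vec n"
    and det: "det (D + U) \<noteq> 0" "det (D + rotation n v z * U) \<noteq> 0" and z: "cmod z = 1" and K: "K > 0"
    and q: "cmod ((resolvent D U *\<^sub>v v) \<bullet>c v) > K * norm_sq v"
    and q': "cmod ((resolvent D (rotation n v z * U) *\<^sub>v v) \<bullet>c v) > K * norm_sq v"
  shows "cmod (z - 1) < 2 / K"
proof -
  define a b s where "a = (resolvent D U *\<^sub>v v) \<bullet>c v"
    and "b = (resolvent D (rotation n v z * U) *\<^sub>v v) \<bullet>c v" and "s = norm_sq v"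
  \<comment> \<open>For \<open>v = 0\<close> both sides of the assumption on the quadratic form are
    0, contradicting its strictness.\<close>
  have v0: "v \<noteq> 0\<^sub>v n"
  proof
    assume "v = 0\<^sub>v n"
    hence "a = 0" unfolding a_def using resolvent_carrier[OF D U det(1)]
      by (simp add: scalar_prod_def)
    moreover have "K * norm_sq v \<ge> 0" using K norm_sq_nonneg[of v] by simp
    ultimately show False using q unfolding a_def by simp
  qed
  have s: "s > 0" using norm_sq_pos[OF v v0] unfolding s_def .
  have ab: "cmod a > K * s" "cmod b > K * s" using q q' unfolding a_def b_def s_def .
  have Ks: "K * s > 0" using K s by simp
  have ab0: "a \<noteq> 0" "b \<noteq> 0" using ab Ks by auto
  have "b = (z - (z - 1) * b / s) * a"
    using resolvent_rotation[OF D U v v0 det] unfolding a_def b_def s_def cscalar_prod_norm_sq .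
  hence "(z - 1) / s = z / b - 1 / a"
    using ab0 s by (simp add: field_simps)
  hence "cmod (z - 1) / s = cmod (z / b - 1 / a)"
    using s by (metis abs_of_pos norm_divide norm_of_real)
  also have "\<dots> \<le> 1 / cmod b + 1 / cmod a"
    using norm_triangle_ineq4[of "z / b" "1 / a"] z by (simp add: norm_divide)
  also have "\<dots> < 1 / (K * s) + 1 / (K * s)"
    using ab ab0 s K by (intro add_strict_mono divide_strict_left_mono mult_pos_pos) auto
  finally show ?thesis using s K by (simp add: field_simps)
qed

section \<open>From quadratic forms to entries, and from entries to the smallest singular
  value\<close>

lemma norm_sq_mult_le:
  assumes W: "W \<in> carrier_mat n n" and y: "y \<in> carrier_vec n" and L: "L \<ge> 0"
    and bound: "\<And>i j. i < n \<Longrightarrow> j < n \<Longrightarrow> cmod (W $$ (i, j)) \<le> L"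
  shows "norm_sq (W *\<^sub>v y) \<le> (real n * L)\<^sup>2 * norm_sq y"
proof -
  have "(cmod ((W *\<^sub>v y) $ i))\<^sup>2 \<le> L\<^sup>2 * (real n * norm_sq y)" if i: "i < n" for i
  proof -
    have "cmod ((W *\<^sub>v y) $ i) = cmod (\<Sum>j<n. W $$ (i, j) * y $ j)"
      using W y i by (simp add: scalar_prod_def atLeast0LessThan)
    also have "\<dots> \<le> (\<Sum>j<n. cmod (W $$ (i, j) * y $ j))" by (rule norm_sum)
    also have "\<dots> \<le> (\<Sum>j<n. L * cmod (y $ j))"
      using bound i by (intro sum_mono) (simp add: norm_mult mult_right_mono)
    also have "\<dots> = L * (\<Sum>j<n. cmod (y $ j))" by (simp add: sum_distrib_left)
    finally have "(cmod ((W *\<^sub>v y) $ i))\<^sup>2 \<le> (L * (\<Sum>j<n. cmod (y $ j)))\<^sup>2"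
      by (intro power_mono) auto
    also have "\<dots> = L\<^sup>2 * (\<Sum>j<n. cmod (y $ j))\<^sup>2" by (simp add: power_mult_distrib)
    \<comment> \<open>Cauchy-Schwarz. It contributes one factor \<open>n\<close>; summation over the
      rows contributes the other.\<close>
    also have "(\<Sum>j<n. cmod (y $ j))\<^sup>2 \<le> real n * norm_sq y"
      using sum_squared_le_sum_of_squares[of "\<lambda>j. cmod (y $ j)" "{..<n}"] y
      by (simp add: norm_sq_def mult.commute)
    finally show ?thesis by (simp add: mult_left_mono)
  qed
  hence "(\<Sum>i<n. (cmod ((W *\<^sub>v y) $ i))\<^sup>2) \<le> (\<Sum>i<n. L\<^sup>2 * (real n * norm_sq y))"
    by (intro sum_mono) auto
  moreover have "norm_sq (W *\<^sub>v y) = (\<Sum>i<n. (cmod ((W *\<^sub>v y) $ i))\<^sup>2)"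
    using W by (simp add: norm_sq_def)
  ultimately show ?thesis by (simp add: power_mult_distrib power2_eq_square mult_ac)
qed

text \<open>For \<open>k < 4\<close> these are the vectors of the complex polarization identity. The
  vector is zero when \<open>i = j\<close> and \<open>k = 2\<close>.\<close>

definition polarization_vec :: "nat \<Rightarrow> nat \<Rightarrow> nat \<Rightarrow> nat \<Rightarrow> complex vec" where
  "polarization_vec n i j k = unit_vec n j + \<i> ^ k \<cdot>\<^sub>v unit_vec n i"

lemma polarization_vec_carrier [simp]: "polarization_vec n i j k \<in> carrier_vec n"
  unfolding polarization_vec_def by simp

lemma norm_sq_polarization_vec_le:
  assumes "i < n" "j < n"
  shows "norm_sq (polarization_vec n i j k) \<le> 4"
proof -
  have "norm_sq (polarization_vec n i j k) =
      (\<Sum>l<n. (cmod (of_bool (l = j) + \<i> ^ k * of_bool (l = i)))\<^sup>2)"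
    using assms by (auto simp: norm_sq_def polarization_vec_def intro!: sum.cong)
  also have "\<dots> \<le> (\<Sum>l<n. 2 * of_bool (l = j) + 2 * of_bool (l = i))"
  proof (rule sum_mono)
    fix l assume "l \<in> {..<n}"
    have "cmod (1 + \<i> ^ k) \<le> 2"
      using norm_triangle_ineq[of 1 "\<i> ^ k"] by (simp add: norm_power)
    hence "(cmod (1 + \<i> ^ k))\<^sup>2 \<le> 2\<^sup>2" by (intro power_mono) auto
    thus "(cmod (of_bool (l = j) + \<i> ^ k * of_bool (l = i)))\<^sup>2
        \<le> 2 * of_bool (l = j) + 2 * of_bool (l = i)"
      by (auto simp: norm_power)
  qed
  also have "\<dots> = 4" using assms by (simp add: sum.distrib of_bool_def flip: sum_distrib_left)
  finally show ?thesis .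
qed

text \<open>After weighting by \<open>\<i> ^ k\<close>, the entries at \<open>(j, j)\<close>,
  \<open>(j, i)\<close> and \<open>(i, i)\<close> carry coefficients that sum to 0 over
  \<open>k < 4\<close>, while the coefficient at \<open>(i, j)\<close> is always 1.\<close>

lemma polarization:
  fixes W :: "complex mat"
  assumes W: "W \<in> carrier_mat n n" and ij: "i < n" "j < n"
  shows "4 * W $$ (i, j) =
    (\<Sum>k<4. \<i> ^ k * ((W *\<^sub>v polarization_vec n i j k) \<bullet>c polarization_vec n i j k))"
proof -
  have "(W *\<^sub>v polarization_vec n i j k) \<bullet>c polarization_vec n i j k =
      W $$ (j, j) + \<i> ^ k * W $$ (j, i) + cnj (\<i> ^ k) * W $$ (i, j) + cnj (\<i> ^ k) * \<i> ^ k * W $$ (i, i)" for k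
  proof -
    have col: "W *\<^sub>v unit_vec n l = col W l" if "l < n" for l
      using W that by (intro eq_vecI) auto
    have 1: "W *\<^sub>v polarization_vec n i j k = col W j + \<i> ^ k \<cdot>\<^sub>v col W i"
      unfolding polarization_vec_def using W ij col
      by (simp add: mult_add_distrib_mat_vec[of _ n n] mult_mat_vec[of _ n n])
    have 2: "x \<bullet>c polarization_vec n i j k = x $ j + cnj (\<i> ^ k) * x $ i" if "x \<in> carrier_vec n" for x
    proof -
      have "x \<bullet>c polarization_vec n i j k = (\<Sum>l<n. x $ l * cnj (polarization_vec n i j k $ l))"
        by (simp add: scalar_prod_def atLeast0LessThan polarization_vec_def)
      also have "\<dots> = (\<Sum>l<n. (if l = j then x $ l else 0) + (if l = i then cnj (\<i> ^ k) * x $ l else 0))"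
        using ij by (intro sum.cong) (auto simp: polarization_vec_def algebra_simps)
      finally show ?thesis using ij by (simp add: sum.distrib)
    qed
    show ?thesis
      unfolding 1 using W ij by (subst 2) (auto simp: algebra_simps)
  qed
  thus ?thesis by (simp add: numeral_eq_Suc power_Suc algebra_simps)
qed

text \<open>Polarization bounds every entry of \<open>resolvent D U\<close> by \<open>4 K\<close>,
  hence its operator norm by \<open>4 K n\<close>. Apply this to \<open>U x = W (D + U) x\<close>,
  where \<open>W\<close> is the resolvent and \<open>x\<close> realizes \<open>s_min\<close>;
  \<open>U\<close> preserves the length of \<open>x\<close>.\<close>

lemma s_min_lower_bound:
  assumes D: "D \<in> carrier_mat n n" and U: "U \<in> unitary_group n" and n: "n > 0"
    and det: "det (D + U) \<noteq> 0" and K: "K \<ge> 0"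
    and q: "\<And>i j k. i < n \<Longrightarrow> j < n \<Longrightarrow> k < 4 \<Longrightarrow>
      cmod ((resolvent D U *\<^sub>v polarization_vec n i j k) \<bullet>c polarization_vec n i j k)
        \<le> K * norm_sq (polarization_vec n i j k)"
  shows "1 \<le> 4 * K * real n * s_min (D + U)"
proof -
  let ?W = "resolvent D U"
  note Uc = unitary_groupD(1)[OF U]
  have W: "?W \<in> carrier_mat n n" using resolvent_carrier[OF D Uc det] .
  have DU: "D + U \<in> carrier_mat n n" using Uc by simp
  have bound: "cmod (?W $$ (i, j)) \<le> 4 * K" if ij: "i < n" "j < n" for i j
  proof -
    let ?v = "polarization_vec n i j"
    have "4 * cmod (?W $$ (i, j)) = cmod (4 * ?W $$ (i, j))" by (simp add: norm_mult)
    also have "\<dots> \<le> (\<Sum>k<4. cmod (\<i> ^ k * ((?W *\<^sub>v ?v k) \<bullet>c ?v k)))"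
      unfolding polarization[OF W ij] by (rule norm_sum)
    also have "\<dots> \<le> (\<Sum>k<(4::nat). K * 4)"
    proof (rule sum_mono)
      fix k :: nat assume "k \<in> {..<4}"
      hence "cmod ((?W *\<^sub>v ?v k) \<bullet>c ?v k) \<le> K * norm_sq (?v k)" using q ij by simp
      also have "\<dots> \<le> K * 4" using K norm_sq_polarization_vec_le[OF ij] by (intro mult_left_mono)
      finally show "cmod (\<i> ^ k * ((?W *\<^sub>v ?v k) \<bullet>c ?v k)) \<le> K * 4"
        by (simp add: norm_mult norm_power)
    qed
    finally show ?thesis by simp
  qed
  obtain x where x: "x \<in> carrier_vec n" "x \<noteq> 0\<^sub>v n" and s0: "s_min (D + U) \<ge> 0"
    and s: "((D + U) *\<^sub>v x) \<bullet>c ((D + U) *\<^sub>v x) = complex_of_real ((s_min (D + U))\<^sup>2) * (x \<bullet>c x)"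
    using s_min_attained[OF DU n] .
  have "complex_of_real (norm_sq ((D + U) *\<^sub>v x)) = complex_of_real ((s_min (D + U))\<^sup>2 * norm_sq x)"
    using s unfolding cscalar_prod_norm_sq by simp
  hence s: "norm_sq ((D + U) *\<^sub>v x) = (s_min (D + U))\<^sup>2 * norm_sq x"
    by (rule of_real_eq_iff[THEN iffD1])
  have "norm_sq x = norm_sq (U *\<^sub>v x)" using norm_sq_unitary[OF U x(1)] by simp
  also have "\<dots> = norm_sq (?W *\<^sub>v ((D + U) *\<^sub>v x))"
    using resolvent_mult_vec[OF D Uc det x(1)] by simp
  also have "\<dots> \<le> (real n * (4 * K))\<^sup>2 * norm_sq ((D + U) *\<^sub>v x)"
    using W bound K mult_mat_vec_carrier[OF DU x(1)] by (intro norm_sq_mult_le) auto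
  also have "\<dots> = (4 * K * real n * s_min (D + U))\<^sup>2 * norm_sq x"
    unfolding s by (simp add: power_mult_distrib mult_ac)
  finally have "1\<^sup>2 \<le> (4 * K * real n * s_min (D + U))\<^sup>2"
    using norm_sq_pos[OF x] by simp
  moreover have "4 * K * real n * s_min (D + U) \<ge> 0" using K s0 by simp
  ultimately show ?thesis by (rule power2_le_imp_le)
qed

section \<open>Haar measure estimates\<close>

lemma space_haar_unitary:
  assumes "haar_unitary n \<mu>"
  shows "space \<mu> = unitary_group n"
proof -
  have "sets \<mu> = sets (unitary_borel n)" using assms unfolding haar_unitary_def by simp
  from sets_eq_imp_space_eq[OF this] show ?thesis unfolding unitary_borel_def by simp
qed

lemma haar_unitary_entry_measurable:
  assumes \<mu>: "haar_unitary n \<mu>" and ij: "i < n" "j < n"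
  shows "(\<lambda>U. U $$ (i, j)) \<in> borel_measurable \<mu>"
proof -
  let ?I = "{..<n} \<times> {..<n}"
  let ?f = "\<lambda>A :: complex mat. \<lambda>(i, j)\<in>?I. A $$ (i, j)"
  have "?f \<in> measurable (unitary_borel n) (\<Pi>\<^sub>M ij\<in>?I. (borel :: complex measure))"
    unfolding unitary_borel_def
    by (rule measurable_vimage_algebra1) (auto simp: space_PiM)
  from measurable_compose[OF this measurable_component_singleton[of "(i, j)"]]
  have "(\<lambda>U. ?f U (i, j)) \<in> borel_measurable (unitary_borel n)" using ij by simp
  moreover have "(\<lambda>U. ?f U (i, j)) = (\<lambda>U. U $$ (i, j))" using ij by auto
  moreover have "sets \<mu> = sets (unitary_borel n)" using \<mu> unfolding haar_unitary_def by simp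
  ultimately show ?thesis by (simp cong: measurable_cong_sets)
qed

lemma borel_measurable_det:
  fixes F :: "'a \<Rightarrow> complex mat"
  assumes carr: "\<And>x. x \<in> space M \<Longrightarrow> F x \<in> carrier_mat k k"
    and meas: "\<And>i j. i < k \<Longrightarrow> j < k \<Longrightarrow> (\<lambda>x. F x $$ (i, j)) \<in> borel_measurable M"
  shows "(\<lambda>x. det (F x)) \<in> borel_measurable M"
proof -
  have "(\<lambda>x. \<Sum>p\<in>{p. p permutes {0..<k}}. signof p * (\<Prod>i = 0..<k. F x $$ (i, p i))) \<in> borel_measurable M"
    by (intro borel_measurable_sum borel_measurable_times borel_measurable_const
        borel_measurable_prod meas) (auto dest: permutes_in_image)
  moreover have "det (F x) = (\<Sum>p\<in>{p. p permutes {0..<k}}. signof p * (\<Prod>i = 0..<k. F x $$ (i, p i)))"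
    if "x \<in> space M" for x
    by (rule det_def'[OF carr[OF that]])
  ultimately show ?thesis by (subst measurable_cong) auto
qed

lemma borel_measurable_adj_mat:
  fixes F :: "'a \<Rightarrow> complex mat"
  assumes carr: "\<And>x. x \<in> space M \<Longrightarrow> F x \<in> carrier_mat k k"
    and meas: "\<And>i j. i < k \<Longrightarrow> j < k \<Longrightarrow> (\<lambda>x. F x $$ (i, j)) \<in> borel_measurable M"
    and ij: "i < k" "j < k"
  shows "(\<lambda>x. adj_mat (F x) $$ (i, j)) \<in> borel_measurable M"
proof -
  have "(\<lambda>x. det (mat_delete (F x) j i)) \<in> borel_measurable M"
  proof (rule borel_measurable_det[where k = "k - 1"])
    fix x assume x: "x \<in> space M"
    show "mat_delete (F x) j i \<in> carrier_mat (k - 1) (k - 1)"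
      using carr[OF x] unfolding mat_delete_def by simp
  next
    fix a b assume ab: "a < k - 1" "b < k - 1"
    \<comment> \<open>The entry \<open>(i, j)\<close> of the adjugate comes from deleting row
      \<open>j\<close> and column \<open>i\<close>; indices from the deleted one onwards shift by
      one.\<close>
    let ?a = "if a < j then a else Suc a" and ?b = "if b < i then b else Suc b"
    have "(\<lambda>x. F x $$ (?a, ?b)) \<in> borel_measurable M" using ab by (intro meas) auto
    moreover have "mat_delete (F x) j i $$ (a, b) = F x $$ (?a, ?b)" if "x \<in> space M" for x
      using carr[OF that] ab unfolding mat_delete_def by simp
    ultimately show "(\<lambda>x. mat_delete (F x) j i $$ (a, b)) \<in> borel_measurable M"
      by (subst measurable_cong) auto
  qed
  hence "(\<lambda>x. (- 1) ^ (j + i) * det (mat_delete (F x) j i)) \<in> borel_measurable M" by simp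
  moreover have "adj_mat (F x) $$ (i, j) = (- 1) ^ (j + i) * det (mat_delete (F x) j i)" if "x \<in> space M" for x
    using carr[OF that] ij unfolding adj_mat_def cofactor_def by simp
  ultimately show ?thesis by (subst measurable_cong) auto
qed

text \<open>For \<open>j < m\<close> this is the point of the first quarter of the unit circle at
  height \<open>j / m\<close>. Distances are then bounded below by differences of imaginary
  parts.\<close>

definition circle_point :: "nat \<Rightarrow> nat \<Rightarrow> complex" where
  "circle_point m j = Complex (sqrt (1 - (real j / real m)\<^sup>2)) (real j / real m)"

lemma cmod_circle_point:
  assumes "j < m"
  shows "cmod (circle_point m j) = 1"
proof -
  have "(real j / real m)\<^sup>2 \<le> 1" using assms by (simp add: power_le_one_iff divide_le_eq_1)
  thus ?thesis unfolding circle_point_def by (simp add: cmod_def)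
qed

lemma circle_point_separation:
  assumes "j < m" "k < m" "j \<noteq> k"
  shows "1 / real m \<le> cmod (circle_point m j - circle_point m k)"
proof -
  have "1 \<le> \<bar>real j - real k\<bar>" using assms(3) by linarith
  hence "1 / real m \<le> \<bar>real j - real k\<bar> / real m" by (intro divide_right_mono) auto
  also have "\<dots> = \<bar>Im (circle_point m j - circle_point m k)\<bar>"
    unfolding circle_point_def by (simp flip: diff_divide_distrib)
  also have "\<dots> \<le> cmod (circle_point m j - circle_point m k)" by (rule abs_Im_le_cmod)
  finally show ?thesis .
qed

lemma cnj_circle_point_mult:
  assumes "j < m"
  shows "cnj (circle_point m j) * circle_point m j = 1"
  using cmod_circle_point[OF assms] complex_norm_square[of "circle_point m j"]
  by (simp add: mult.commute)

section \<open>Probabilities of the singular set and of large quadratic forms\<close>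

definition singular_set :: "complex mat measure \<Rightarrow> complex mat \<Rightarrow> complex mat set" where
  "singular_set \<mu> D = {U \<in> space \<mu>. det (D + U) = 0}"

text \<open>On this set \<open>resolvent D U\<close> is a genuine \<open>U (D + U)^-1\<close>, as
  the Moebius relation requires; singular sums are collected in \<open>singular_set\<close>.\<close>

definition bad_set :: "complex mat measure \<Rightarrow> complex mat \<Rightarrow> real \<Rightarrow> complex vec \<Rightarrow> complex mat set" where
  "bad_set \<mu> D K v = {U \<in> space \<mu>. det (D + U) \<noteq> 0 \<and>
     cmod ((resolvent D U *\<^sub>v v) \<bullet>c v) > K * norm_sq v}"

context
  fixes n :: nat and \<mu> :: "complex mat measure" and D :: "complex mat"
  assumes \<mu>: "haar_unitary n \<mu>" and D: "D \<in> carrier_mat n n"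
begin

interpretation prob_space \<mu>
  using \<mu> unfolding haar_unitary_def by simp

lemma haar_carrier: "U \<in> space \<mu> \<Longrightarrow> U \<in> carrier_mat n n"
  using space_haar_unitary[OF \<mu>] unitary_groupD(1) by auto

lemma sum_entry_measurable:
  assumes ij: "i < n" "j < n"
  shows "(\<lambda>U. (D + U) $$ (i, j)) \<in> borel_measurable \<mu>"
proof -
  have "(\<lambda>U. D $$ (i, j) + U $$ (i, j)) \<in> borel_measurable \<mu>"
    using haar_unitary_entry_measurable[OF \<mu> ij] by simp
  moreover have "(D + U) $$ (i, j) = D $$ (i, j) + U $$ (i, j)" if "U \<in> space \<mu>" for U
    using haar_carrier[OF that] ij by simp
  ultimately show ?thesis by (subst measurable_cong) auto
qed

lemma det_sum_measurable [measurable]: "(\<lambda>U. det (D + U)) \<in> borel_measurable \<mu>"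
  using sum_entry_measurable haar_carrier D by (intro borel_measurable_det[where k = n]) auto

lemma singular_set_measurable: "singular_set \<mu> D \<in> sets \<mu>"
  unfolding singular_set_def by measurable

lemma bad_set_measurable:
  assumes v: "v \<in> carrier_vec n"
  shows "bad_set \<mu> D K v \<in> sets \<mu>"
proof -
  have [measurable]: "(\<lambda>U. adj_mat (D + U) $$ (i, j)) \<in> borel_measurable \<mu>" if "i < n" "j < n" for i j
    using that sum_entry_measurable haar_carrier D by (intro borel_measurable_adj_mat[where k = n]) auto
  have [measurable]: "(\<lambda>U. U $$ (i, j)) \<in> borel_measurable \<mu>" if "i < n" "j < n" for i j
    using haar_unitary_entry_measurable[OF \<mu> that] .
  have "(\<lambda>U. \<Sum>i<n. \<Sum>j<n. \<Sum>k<n. 1 / det (D + U) * (U $$ (i, k) * adj_mat (D + U) $$ (k, j)) * v $ j * cnj (v $ i))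
      \<in> borel_measurable \<mu>"
    by measurable
  moreover have "(resolvent D U *\<^sub>v v) \<bullet>c v =
      (\<Sum>i<n. \<Sum>j<n. \<Sum>k<n. 1 / det (D + U) * (U $$ (i, k) * adj_mat (D + U) $$ (k, j)) * v $ j * cnj (v $ i))"
    if "U \<in> space \<mu>" for U
    using haar_carrier[OF that] D v adj_mat(1)[of "D + U" n] unfolding resolvent_def
    by (auto simp: scalar_prod_def atLeast0LessThan sum_distrib_left sum_distrib_right intro!: sum.cong)
  ultimately have [measurable]: "(\<lambda>U. (resolvent D U *\<^sub>v v) \<bullet>c v) \<in> borel_measurable \<mu>"
    by (subst measurable_cong) auto
  show ?thesis unfolding bad_set_def by measurable
qed

text \<open>Double counting: integrate the number of translates of \<open>E\<close> that contain
  \<open>U\<close>. By invariance the integral is \<open>card J\<close> times the measure of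
  \<open>E\<close>, and the integrand is at most \<open>k\<close>.\<close>

lemma haar_translates_bound:
  assumes E: "E \<in> sets \<mu>" and J: "finite J" and V: "\<And>j. j \<in> J \<Longrightarrow> V j \<in> unitary_group n"
    and mult: "\<And>U. U \<in> space \<mu> \<Longrightarrow> card {j \<in> J. U \<in> (\<lambda>U. V j * U) ` E} \<le> k"
  shows "real (card J) * prob E \<le> real k"
proof (cases "emeasure \<mu> E = 0")
  case True
  thus ?thesis by (simp add: measure_def)
next
  case False
  let ?E = "\<lambda>j. (\<lambda>U. V j * U) ` E"
  have eq: "emeasure \<mu> (?E j) = emeasure \<mu> E" if "j \<in> J" for j
    using \<mu> E V[OF that] unfolding haar_unitary_def by simp
  \<comment> \<open>A set outside the sigma-algebra has \<open>emeasure\<close> 0 by convention. A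
    translate has the nonzero measure of \<open>E\<close>, so it is measurable; this is why the null
    case is treated separately.\<close>
  hence meas: "?E j \<in> sets \<mu>" if "j \<in> J" for j
    using False that emeasure_neq_0_sets by metis
  have "of_nat (card J) * emeasure \<mu> E = (\<Sum>j\<in>J. \<integral>\<^sup>+U. indicator (?E j) U \<partial>\<mu>)"
    using meas eq by simp
  also have "\<dots> = (\<integral>\<^sup>+U. (\<Sum>j\<in>J. indicator (?E j) U) \<partial>\<mu>)"
    using meas by (subst nn_integral_sum) auto
  also have "\<dots> \<le> (\<integral>\<^sup>+U. of_nat k \<partial>\<mu>)"
  proof (rule nn_integral_mono)
    fix U assume U: "U \<in> space \<mu>"
    have "(\<Sum>j\<in>J. indicator (?E j) U :: ennreal) = of_nat (card {j \<in> J. U \<in> ?E j})"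
      using J by (simp add: indicator_def sum.If_cases Int_def)
    also have "\<dots> \<le> of_nat k" using mult[OF U] by simp
    finally show "(\<Sum>j\<in>J. indicator (?E j) U) \<le> (of_nat k :: ennreal)" .
  qed
  also have "\<dots> = of_nat k" by (simp add: emeasure_space_1)
  finally have "ennreal (real (card J) * prob E) \<le> ennreal (real k)"
    by (simp add: emeasure_eq_measure ennreal_mult ennreal_of_nat_eq_real_of_nat)
  thus ?thesis by simp
qed

text \<open>The rotations by the \<open>m\<close> circle points move the bad set to pairwise
  disjoint sets of equal measure.\<close>

lemma prob_bad_set:
  assumes v: "v \<in> carrier_vec n" "v \<noteq> 0\<^sub>v n" and m: "m > 0"
  shows "prob (bad_set \<mu> D (2 * real m) v) \<le> 1 / real m"
proof -
  let ?E = "bad_set \<mu> D (2 * real m) v"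
  let ?z = "circle_point m" and ?R = "rotation n v"
  have "j = k" if jk: "j < m" "k < m" and U: "U \<in> (\<lambda>U. ?R (?z j) * U) ` ?E" "U \<in> (\<lambda>U. ?R (?z k) * U) ` ?E" for j k U
  proof (rule ccontr)
    assume ne: "j \<noteq> k"
    obtain U0 U1 where U0: "U = ?R (?z j) * U0" "U0 \<in> ?E" and U1: "U = ?R (?z k) * U1" "U1 \<in> ?E"
      using U by (elim imageE)
    have carr: "U0 \<in> carrier_mat n n" "U1 \<in> carrier_mat n n"
      using U0(2) U1(2) haar_carrier unfolding bad_set_def by auto
    \<comment> \<open>If \<open>U\<close> lies in two translates, its preimages \<open>U0\<close>
      and \<open>U1\<close> differ by the rotation by \<open>?w\<close>. Both are bad for
      \<open>K = 2 m\<close>, which forces \<open>?w\<close> closer to 1 than \<open>1 / m\<close>,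
      against the separation of the circle points.\<close>
    let ?w = "cnj (?z k) * ?z j"
    have "U1 = ?R (cnj (?z k) * ?z k) * U1"
      unfolding cnj_circle_point_mult[OF jk(2)] rotation_one using carr by simp
    also have "\<dots> = ?R (cnj (?z k)) * U"
      unfolding U1(1) rotation_mult[OF v, symmetric] using carr by (simp add: assoc_mult_mat[of _ n n _ n _ n])
    also have "\<dots> = ?R ?w * U0"
      unfolding U0(1) rotation_mult[OF v, symmetric] using carr by (simp add: assoc_mult_mat[of _ n n _ n _ n])
    finally have U1': "U1 = ?R ?w * U0" .
    have "cmod (?w - 1) < 2 / (2 * real m)"
    proof (rule resolvent_rotation_separation[OF D carr(1) v(1)])
      show "cmod ?w = 1" using jk by (simp add: norm_mult cmod_circle_point)
    qed (use U0(2) U1(2) m in \<open>auto simp: bad_set_def simp flip: U1'\<close>)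
    moreover have "?w - 1 = cnj (?z k) * (?z j - ?z k)"
      using cnj_circle_point_mult[OF jk(2)] by (simp add: algebra_simps)
    hence "cmod (?w - 1) = cmod (?z j - ?z k)"
      using jk by (simp add: norm_mult cmod_circle_point)
    ultimately show False using circle_point_separation[OF jk ne] by simp
  qed
  hence "card {j \<in> {..<m}. U \<in> (\<lambda>U. ?R (?z j) * U) ` ?E} \<le> Suc 0" for U
    by (subst card_le_Suc0_iff_eq) auto
  hence "real (card {..<m}) * prob ?E \<le> real (Suc 0)"
    using cmod_circle_point rotation_unitary[OF v] bad_set_measurable[OF v(1)]
    by (intro haar_translates_bound[where V = "\<lambda>j. ?R (?z j)"]) auto
  thus ?thesis using m by (simp add: field_simps)
qed

text \<open>Translate by the scalar matrices of \<open>m\<close> circle points. Every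
  \<open>U\<close> lies in at most \<open>n\<close> translates, because each one produces a
  different eigenvalue of \<open>mat_adjoint U * D\<close>. Hence \<open>m\<close> times the
  probability is at most \<open>n\<close> for all \<open>m\<close>.\<close>

lemma prob_singular_set: "prob (singular_set \<mu> D) = 0"
proof -
  let ?S = "singular_set \<mu> D"
  have bound: "real m * prob ?S \<le> real n" for m
  proof -
    let ?z = "circle_point m"
    let ?V = "\<lambda>j. ?z j \<cdot>\<^sub>m 1\<^sub>m n"
    have "?V j \<in> unitary_group n" if "j < m" for j
    proof (rule unitary_groupI)
      show "mat_adjoint (?V j) * ?V j = 1\<^sub>m n"
        using cnj_circle_point_mult[OF that] 
        by (intro eq_matI) (auto simp: scalar_prod_def if_distrib[of "\<lambda>x. _ * x"] sum.delta cong: if_cong)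
    qed simp
    moreover have "card {j \<in> {..<m}. U \<in> (\<lambda>U. ?V j * U) ` ?S} \<le> n" if U: "U \<in> space \<mu>" for U
    proof -
      let ?J = "{j \<in> {..<m}. U \<in> (\<lambda>U. ?V j * U) ` ?S}"
      let ?M = "mat_adjoint U * D"
      have Uu: "U \<in> carrier_mat n n" "mat_adjoint U * U = 1\<^sub>m n"
        using U space_haar_unitary[OF \<mu>] unitary_groupD by auto
      have M: "?M \<in> carrier_mat n n" using Uu(1) D by auto
      \<comment> \<open>If \<open>U\<close> is \<open>?z j\<close> times a singular
        \<open>U0\<close>, apply \<open>mat_adjoint U\<close> to a kernel vector equation of
        \<open>D + cnj (?z j) U\<close>; it becomes an eigenvector equation for
        \<open>?M\<close>.\<close>
      have "(\<lambda>j. - cnj (?z j)) ` ?J \<subseteq> spectrum ?M"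
      proof (rule subsetI)
        fix y assume "y \<in> (\<lambda>j. - cnj (?z j)) ` ?J"
        then obtain j U0 where y: "y = - cnj (?z j)" and j: "j < m" and UU: "U = ?V j * U0" and U0: "U0 \<in> ?S"
          by blast
        have U0c: "U0 \<in> carrier_mat n n" using U0 haar_carrier unfolding singular_set_def by auto
        have U0e: "U0 = cnj (?z j) \<cdot>\<^sub>m U"
          unfolding UU using U0c cnj_circle_point_mult[OF j]
          by (intro eq_matI) (auto simp: mult_smult_assoc_mat[of _ n n _ n] simp flip: mult.assoc)
        have "det (D + U0) = 0" using U0 unfolding singular_set_def by simp
        then obtain x where x: "x \<in> carrier_vec n" "x \<noteq> 0\<^sub>v n" "(D + U0) *\<^sub>v x = 0\<^sub>v n"
          using det_0_iff_vec_prod_zero_field[of "D + U0" n] U0c by auto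
        have "D *\<^sub>v x + cnj (?z j) \<cdot>\<^sub>v (U *\<^sub>v x) = 0\<^sub>v n"
          using x(1,3) add_mult_distrib_mat_vec[OF D U0c x(1)] Uu(1)
            smult_mat_mult_vec[OF Uu(1) x(1)] unfolding U0e by simp
        moreover have "mat_adjoint U *\<^sub>v 0\<^sub>v n = 0\<^sub>v n" using Uu(1) by (intro eq_vecI) auto
        ultimately have "mat_adjoint U *\<^sub>v (D *\<^sub>v x + cnj (?z j) \<cdot>\<^sub>v (U *\<^sub>v x)) = 0\<^sub>v n" by simp
        hence 0: "?M *\<^sub>v x + cnj (?z j) \<cdot>\<^sub>v x = 0\<^sub>v n"
          using x D Uu by (simp add: mult_add_distrib_mat_vec[of _ n n] mult_mat_vec[of _ n n]
              flip: assoc_mult_mat_vec[of _ n n _ n])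
        have "?M *\<^sub>v x = - cnj (?z j) \<cdot>\<^sub>v x"
        proof (rule eq_vecI)
          fix i assume "i < dim_vec (- cnj (?z j) \<cdot>\<^sub>v x)"
          hence i: "i < n" using x by simp
          have "(?M *\<^sub>v x) $ i + cnj (?z j) * x $ i = (?M *\<^sub>v x + cnj (?z j) \<cdot>\<^sub>v x) $ i"
            using i x M by simp
          also have "\<dots> = 0" unfolding 0 using i by simp
          finally show "(?M *\<^sub>v x) $ i = (- cnj (?z j) \<cdot>\<^sub>v x) $ i"
            using i x by (simp add: add_eq_0_iff2)
        qed (use x M in auto)
        hence "eigenvector ?M x (- cnj (?z j))"
          using x M unfolding eigenvector_def by auto
        thus "y \<in> spectrum ?M" unfolding y spectrum_def eigenvalue_def by auto
      qed
      moreover have "inj_on (\<lambda>j. - cnj (?z j)) ?J"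
      proof (rule inj_onI, rule ccontr)
        fix j k assume "j \<in> ?J" "k \<in> ?J" "- cnj (?z j) = - cnj (?z k)" "j \<noteq> k"
        thus False using circle_point_separation[of j m k] by auto
      qed
      ultimately have "card ?J \<le> card (spectrum ?M)"
        using card_inj_on_le card_finite_spectrum(1)[OF M] by blast
      also have "\<dots> \<le> n" by (rule card_finite_spectrum(2)[OF M])
      finally show ?thesis .
    qed
    ultimately have "real (card {..<m}) * prob ?S \<le> real n"
      using singular_set_measurable by (intro haar_translates_bound[where V = ?V]) auto
    thus ?thesis by simp
  qed
  show ?thesis
  proof (rule ccontr)
    assume "prob ?S \<noteq> 0"
    hence pos: "prob ?S > 0" using measure_nonneg[of \<mu> ?S] by linarith
    obtain m :: nat where "real n < real m * prob ?S"
      using ex_less_of_nat_mult[OF pos] by auto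
    thus False using bound[of m] by simp
  qed
qed

text \<open>Union bound over the \<open>4 n^2\<close> polarization vectors with
  \<open>K = 2 m\<close>. Off the exceptional sets, \<open>s_min (D + U)\<close> is at least
  \<open>1 / (8 m n)\<close>, which exceeds \<open>t\<close>.\<close>

lemma prob_s_min_le:
  assumes n: "n > 0" and m: "m > 0" and t: "8 * real m * real n * t < 1"
  shows "\<P>(U in \<mu>. s_min (D + U) \<le> t) \<le> 4 * (real n)\<^sup>2 / real m"
proof -
  let ?K = "2 * real m"
  let ?I = "{..<n} \<times> {..<n} \<times> {..<4::nat}"
  let ?B = "\<lambda>(i, j, k). bad_set \<mu> D ?K (polarization_vec n i j k)"
  let ?T = "{U \<in> space \<mu>. s_min (D + U) \<le> t}"
  have meas: "?B x \<in> sets \<mu>" for x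
    by (cases x) (simp add: bad_set_measurable)
  have small: "prob (?B x) \<le> 1 / real m" for x
  proof (cases x)
    case (fields i j k)
    show ?thesis
    proof (cases "polarization_vec n i j k = 0\<^sub>v n")
      case True
      \<comment> \<open>A zero polarization vector is outside the scope of
        \<open>prob_bad_set\<close>, but its bad set is empty since the defining inequality reads
        \<open>0 > 0\<close>.\<close>
      have "((resolvent D U *\<^sub>v 0\<^sub>v n) \<bullet>c 0\<^sub>v n) = (0 :: complex)" if "U \<in> space \<mu>" for U
        using haar_carrier[OF that] D by (simp add: scalar_prod_def resolvent_def)
      hence "?B x = {}" by (auto simp: fields bad_set_def True norm_sq_def)
      thus ?thesis by simp
    next
      case False
      thus ?thesis using prob_bad_set[OF _ False m] by (simp add: fields)
    qed
  qed
  have "?T \<subseteq> singular_set \<mu> D \<union> (\<Union>x\<in>?I. ?B x)"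
  proof (rule subsetI, rule ccontr)
    fix U assume U: "U \<in> ?T" and out: "U \<notin> singular_set \<mu> D \<union> (\<Union>x\<in>?I. ?B x)"
    have "1 \<le> 4 * ?K * real n * s_min (D + U)"
    proof (rule s_min_lower_bound[OF D _ n])
      show "U \<in> unitary_group n" using U space_haar_unitary[OF \<mu>] by simp
      show det: "det (D + U) \<noteq> 0" using U out unfolding singular_set_def by simp
      fix i j k :: nat assume "i < n" "j < n" "k < 4"
      hence "U \<notin> ?B (i, j, k)" using out by blast
      thus "cmod ((resolvent D U *\<^sub>v polarization_vec n i j k) \<bullet>c polarization_vec n i j k)
          \<le> ?K * norm_sq (polarization_vec n i j k)"
        using U det unfolding bad_set_def by auto
    qed simp
    also have "\<dots> \<le> 4 * ?K * real n * t" using U by (intro mult_left_mono) auto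
    finally show False using t by simp
  qed
  \<comment> \<open>Monotonicity asks for measurability of the larger set; a nonmeasurable
    \<open>?T\<close> would have measure 0 by convention, so the bound holds in any case.\<close>
  moreover have "singular_set \<mu> D \<union> (\<Union>x\<in>?I. ?B x) \<in> sets \<mu>"
    using meas singular_set_measurable by (intro sets.Un sets.finite_UN) auto
  ultimately have "prob ?T \<le> prob (singular_set \<mu> D \<union> (\<Union>x\<in>?I. ?B x))"
    by (rule finite_measure_mono)
  also have "\<dots> \<le> prob (singular_set \<mu> D) + prob (\<Union>x\<in>?I. ?B x)"
    using meas singular_set_measurable by (intro measure_Un_le sets.finite_UN) auto
  also have "prob (\<Union>x\<in>?I. ?B x) \<le> (\<Sum>x\<in>?I. prob (?B x))"
    using meas by (intro finite_measure_subadditive_finite) auto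
  also have "\<dots> \<le> (\<Sum>x\<in>?I. 1 / real m)" by (intro sum_mono small)
  also have "\<dots> = 4 * (real n)\<^sup>2 / real m" by (simp add: power2_eq_square)
  finally show ?thesis by (simp add: prob_singular_set)
qed

end

text \<open>The estimates give a bound \<open>72 n^3 t\<close>. As \<open>n\<close> is at least 2,
  the factor 72 is absorbed into \<open>n^7\<close>, which explains the exponent 10; the exponent of
  \<open>t\<close> is 1.\<close>

theorem theorem1p1:
  shows "\<exists>C c :: real. C > 0 \<and> c > 0 \<and>
    (\<forall>(n :: nat) (D :: complex mat) (\<mu> :: complex mat measure) (t :: real).
       n \<ge> 2 \<longrightarrow> D \<in> carrier_mat n n \<longrightarrow> haar_unitary n \<mu> \<longrightarrow> t > 0 \<longrightarrow>
       \<P>(U in \<mu>. s_min (D + U) \<le> t) \<le> t powr c * real n powr C)"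
proof (rule exI[of _ 10], rule exI[of _ 1], intro conjI allI impI)
  fix n :: nat and D :: "complex mat" and \<mu> :: "complex mat measure" and t :: real
  assume n: "n \<ge> 2" and D: "D \<in> carrier_mat n n" and \<mu>: "haar_unitary n \<mu>" and t: "t > 0"
  interpret prob_space \<mu> using \<mu> unfolding haar_unitary_def by simp
  have rhs: "t powr 1 * real n powr 10 = t * real n ^ 10" using t n by simp
  show "\<P>(U in \<mu>. s_min (D + U) \<le> t) \<le> t powr 1 * real n powr 10"
  \<comment> \<open>For \<open>t\<close> at least \<open>1 / (18 n)\<close> the claimed bound is
    already at least 1, because \<open>18 \<le> 2 ^ 9\<close>.\<close>
  proof (cases "18 * real n * t \<ge> 1")
    case True
    have "(18 :: real) \<le> 2 ^ 9" by simp
    also have "\<dots> \<le> real n ^ 9" using n by (intro power_mono) auto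
    finally have "18 * real n * t \<le> real n ^ 9 * real n * t"
      using t by (intro mult_right_mono) auto
    hence "1 \<le> t * real n ^ 10" using True by (simp add: power_numeral_reduce mult_ac)
    thus ?thesis unfolding rhs using prob_le_1 order_trans by blast
  next
    case False
    \<comment> \<open>Rounding \<open>y\<close> up gives \<open>m < y + 1 < 2 y\<close>, so
      \<open>8 m n t\<close> is at most \<open>16 / 18\<close>. The constant 18 is chosen above 16
      to leave this room.\<close>
    define y where "y = 1 / (18 * real n * t)"
    define m where "m = nat \<lceil>y\<rceil>"
    have nt: "18 * real n * t > 0" using n t by simp
    have y: "y > 1" using False nt unfolding y_def by simp
    have m: "y \<le> real m" "real m < y + 1" using y unfolding m_def by linarith+
    have ynt: "y * (18 * real n * t) = 1" using n t unfolding y_def by simp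
    have "8 * real m * real n * t = real m * (8 * real n * t)" by simp
    also have "\<dots> \<le> (2 * y) * (8 * real n * t)"
      using m y t by (intro mult_right_mono) auto
    also have "\<dots> < 1" using ynt by simp
    finally have "\<P>(U in \<mu>. s_min (D + U) \<le> t) \<le> 4 * (real n)\<^sup>2 / real m"
      using m y n by (intro prob_s_min_le[OF \<mu> D]) auto
    also have "\<dots> \<le> 4 * (real n)\<^sup>2 / y" using m y by (intro divide_left_mono) auto
    also have "\<dots> = 72 * (real n ^ 3 * t)" unfolding y_def by (simp add: power_numeral_reduce)
    also have "\<dots> \<le> real n ^ 7 * (real n ^ 3 * t)"
    proof (rule mult_right_mono)
      have "(72 :: real) \<le> 2 ^ 7" by simp
      also have "\<dots> \<le> real n ^ 7" using n by (intro power_mono) auto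
      finally show "72 \<le> real n ^ 7" .
    qed (use t in simp)
    also have "\<dots> = t * real n ^ 10" by (simp add: mult_ac flip: power_add)
    finally show ?thesis unfolding rhs .
  qed
qed simp_all

end
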